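(* Let $n\ge 4$ and assume that the equation $F(a)=0$ has exactly two positive solutions, denoted $z_1<z_2$. Then there exists an admissible value $a_1>1$ such that: 1. for every mass ratio $m>1$ there exist at least three different twisted $(2,n)$-crowns with mass ratio $m$: one with admissible value $a\in(1/a_1,1/z_2)$, one with $a\in(1,1/z_1)$ and one with $a\in(a_1,\infty)$; 2. for $m=1$ there exist at least two different twisted $(2,n)$-crowns. If $n$ is even, there are exactly two, with admissible values $a=1$ and $a=a_1$, respectively.
   Context: Let $n\ge 2$ be an integer. For $a>0$ and $m>0$ consider $2n$ bodies in the plane $\mathbb{R}^2\cong\mathbb{C}$: $n$ bodies of mass $1$ at the points $e^{2\pi i k/n}$, $k=0,\dots,n-1$, and $n$ bodies of mass $m$ at the points $a\,e^{i(\pi/n+2\pi k/n)}$, $k=0,\dots,n-1$. The center of mass is at the origin. Configuration $(q_i)$ with masses $(\mu_i)$ is a central configuration if there is $\lambda\in\mathbb{R}$ such that $\nabla_{q_i}U+\lambda\mu_i q_i=0$ for all $i$, where $U=\sum_{i<j}\mu_i\mu_j/\|q_i-q_j\|$. If the configuration of $2n$ bodies consisting of $n$ bodies of mass $1$ at the points $e^{2\pi i k/n}$ and $n$ bodies of mass $m$ at the points $a\,e^{i(\pi/n+2\pi k/n)}$, $k=0,\dots,n-1$, is central, it is called a twisted $(2,n)$-crown with radius $a$ and mass ratio $m$; it is encoded by the pair $(a,m)$. A value $a>0$ is admissible if there exists $m>0$ such that the configuration with parameters $(a,m)$ is a twisted $(2,n)$-crown. Put $S_n=\frac14\sum_{k=1}^{n-1}\frac{1}{\sin(k\pi/n)}$,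 $\theta_k=(2k-1)\pi/n$, and $$C_{12}(a)=\sum_{k=1}^n\frac{1-a\cos\theta_k}{(1+a^2-2a\cos\theta_k)^{3/2}},\qquad C_{21}(a)=\sum_{k=1}^n\frac{a-\cos\theta_k}{(1+a^2-2a\cos\theta_k)^{3/2}},$$ $$F(a)=S_na-C_{21}(a),\qquad G(a)=S_n-a^3C_{12}(a),\qquad H(a)=a^2\frac{F(a)}{G(a)}.$$ The configuration with parameters $(a,m)$ is a twisted $(2,n)$-crown if and only if $(C_{21}(a)-S_na)+\left(\frac{S_n}{a^2}-aC_{12}(a)\right)m=0$, that is, $m=H(a)$ when $G(a)\neq0$. The pair $(a,m)$ gives a twisted $(2,n)$-crown if and only if $(1/a,1/m)$ does, and these two are the same configuration up to scaling. Two crowns $(a,m)$ and $(a',m')$ are called different if $(a',m')\notin\{(a,m),(1/a,1/m)\}$. In particular, for fixed $m>1$ different values of $a$ give different crowns, while for $m=1$ the values $a$ and $1/a$ are identified. *)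

theory Defs
  imports "HOL-Analysis.Analysis"
begin

text \<open>
  The bodies are numbered by \<open>0, \<dots>, N - 1\<close>; the values of \<open>\<mu>\<close> and \<open>q\<close> at other indices are
  irrelevant. The plane is \<open>complex\<close>, whose inner product (hence gradient) is that of
  \<open>\<real>\<^sup>2\<close>.
\<close>

definition newton_potential :: "nat \<Rightarrow> (nat \<Rightarrow> real) \<Rightarrow> (nat \<Rightarrow> complex) \<Rightarrow> real" where
  "newton_potential N \<mu> q = (\<Sum>j<N. \<Sum>i<j. \<mu> i * \<mu> j / norm (q i - q j))"

text \<open>
  The partial gradient with respect to \<open>q i\<close> is required to exist. For positive masses this
  excludes collisions, where the convention \<open>x / 0 = 0\<close> makes the potential discontinuous.
\<close>

definition central_configuration :: "nat \<Rightarrow> (nat \<Rightarrow> real) \<Rightarrow> (nat \<Rightarrow> complex) \<Rightarrow> bool" where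
  "central_configuration N \<mu> q \<longleftrightarrow>
     (\<exists>l::real. \<forall>i<N. \<exists>g::complex.
        (GDERIV (\<lambda>x. newton_potential N \<mu> (q(i := x))) (q i) :> g) \<and>
        g + (l * \<mu> i) *\<^sub>R q i = 0)"

definition crown_mass :: "nat \<Rightarrow> real \<Rightarrow> nat \<Rightarrow> real" where
  "crown_mass n m i = (if i < n then 1 else m)"

definition crown_position :: "nat \<Rightarrow> real \<Rightarrow> nat \<Rightarrow> complex" where
  "crown_position n a i =
     (if i < n then cis (2 * pi * real i / real n)
      else of_real a * cis (pi / real n + 2 * pi * real (i - n) / real n))"

definition twisted_crown :: "nat \<Rightarrow> real \<Rightarrow> real \<Rightarrow> bool" where
  "twisted_crown n a m \<longleftrightarrow>
     a > 0 \<and> m > 0 \<and> central_configuration (2 * n) (crown_mass n m) (crown_position n a)"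

definition admissible :: "nat \<Rightarrow> real \<Rightarrow> bool" where
  "admissible n a \<longleftrightarrow> (\<exists>m>0. twisted_crown n a m)"

definition different_crowns :: "real \<times> real \<Rightarrow> real \<times> real \<Rightarrow> bool" where
  "different_crowns p p' \<longleftrightarrow> p' \<notin> {p, (1 / fst p, 1 / snd p)}"

definition S :: "nat \<Rightarrow> real" where
  "S n = 1 / 4 * (\<Sum>k=1..n-1. 1 / sin (real k * pi / real n))"

definition \<theta> :: "nat \<Rightarrow> nat \<Rightarrow> real" where
  "\<theta> n k = (2 * real k - 1) * pi / real n"

definition C21 :: "nat \<Rightarrow> real \<Rightarrow> real" where
  "C21 n a =
     (\<Sum>k=1..n. (a - cos (\<theta> n k)) / (1 + a\<^sup>2 - 2 * a * cos (\<theta> n k)) powr (3 / 2))"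

definition F :: "nat \<Rightarrow> real \<Rightarrow> real" where
  "F n a = S n * a - C21 n a"

end

theory Submission
  imports Defs
begin

text \<open>
  By rotational symmetry all forces in a crown are radial, so being central is one real equation,
  and the scaling \<open>a \<mapsto> 1 / a\<close>, which exchanges the two polygons, brings it into the form
  \<open>m F(1 / a) = a F(a)\<close> (lemma \<open>twisted_crown_iff\<close>). Everything else concerns the signs of
  \<open>F\<close> and continuity.

  The function \<open>F\<close> is positive near \<open>0\<close> and near infinity and negative at \<open>1\<close>. With exactly two
  zeros this gives \<open>z1 < 1 < z2\<close> and the signs \<open>+ - +\<close> in between. The decisive point is
  \<open>z1 * z2 > 1\<close> (lemma \<open>inverse_z2_less_z1\<close>), that is \<open>F(1 / z2) > 0\<close>. For \<open>n \<ge> 5\<close> it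
  follows from Chebyshev's sum inequality for powers of the distances between the polygons and from
  the closed form of the sum of their inverse squares (lemma \<open>F_inverse_pos_at_zero\<close>); for
  \<open>n = 4\<close> two values of \<open>F\<close> suffice.

  Since \<open>F(1 / z2) > 0\<close>, at \<open>a = z2\<close> the left side \<open>m F(1 / a)\<close> of the equation is larger
  than the right side \<open>a F(a) = 0\<close>, while for large \<open>a\<close> the right side is larger. For \<open>m = 1\<close> this
  yields a crown of radius \<open>a1 > z2\<close>. For \<open>m > 1\<close> the left side exceeds the right side at
  \<open>a1\<close>, which produces a crown beyond \<open>a1\<close>. The other two come from sign changes on
  \<open>(1 / a1, 1 / z2)\<close> and \<open>(1, 1 / z1)\<close>. The regular \<open>2 n\<close>-gon \<open>a = 1\<close> is a second crown
  for \<open>m = 1\<close>.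

  If \<open>n\<close> is even, the crown equation for \<open>m = 1\<close> and \<open>a > 1\<close> separates, in the variable
  \<open>v = sqrt a + 1 / sqrt a\<close>, into a strictly increasing and a decreasing side. The half-turn symmetry
  of the polygon is what makes the second side monotone; it pairs the contributions of opposite
  vertices. Hence \<open>a1\<close> is the only radius above \<open>1\<close>.
\<close>

section \<open>Central configurations as balance of forces\<close>

text \<open>
  The gravitational acceleration that a unit mass at \<open>x\<close> causes at \<open>p\<close>. Its value \<open>0\<close> at
  \<open>x = p\<close> lets the sums below run over all bodies, the attracted one included.
\<close>

definition attraction :: "complex \<Rightarrow> complex \<Rightarrow> complex" where
  "attraction p x = (x - p) /\<^sub>R norm (x - p) ^ 3"

lemma GDERIV_inverse_norm:
  assumes "p \<noteq> x"
  shows "GDERIV (\<lambda>p. c / norm (p - x)) p :> c *\<^sub>R attraction p x"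
proof -
  have pos: "norm (p - x) > 0" using assms by simp
  have d: "((\<lambda>p. norm (p - x)) has_derivative (\<lambda>h. h \<bullet> sgn (p - x))) (at p)"
  proof (rule has_derivative_compose[of "\<lambda>p. p - x" "\<lambda>h. h"])
    show "((\<lambda>p. p - x) has_derivative (\<lambda>h. h)) (at p)"
      by (auto intro!: derivative_eq_intros)
    show "(norm has_derivative (\<lambda>h. h \<bullet> sgn (p - x))) (at (p - x))"
      using GDERIV_norm[of "p - x"] assms by (simp add: gderiv_def)
  qed
  have "((\<lambda>p. c / norm (p - x)) has_derivative
      (\<lambda>h. - c * (h \<bullet> sgn (p - x)) / (norm (p - x))\<^sup>2)) (at p)"
    using pos by (auto intro!: derivative_eq_intros d simp: power2_eq_square divide_simps)
  moreover have "(\<lambda>h. - c * (h \<bullet> sgn (p - x)) / (norm (p - x))\<^sup>2)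
      = (\<lambda>h. h \<bullet> (c *\<^sub>R attraction p x))"
  proof
    fix h
    have "x - p = - (p - x)" by simp
    then have "h \<bullet> (c *\<^sub>R attraction p x) = - c * (h \<bullet> (p - x)) / norm (p - x) ^ 3"
      unfolding attraction_def by (simp add: norm_minus_commute inner_diff_right divide_simps algebra_simps)
    then show "- c * (h \<bullet> sgn (p - x)) / (norm (p - x))\<^sup>2 = h \<bullet> (c *\<^sub>R attraction p x)"
      using pos by (simp add: sgn_div_norm power2_eq_square power3_eq_cube divide_simps)
  qed
  ultimately show ?thesis by (simp add: gderiv_def)
qed

text \<open>
  The potential is a sum over unordered pairs. Splitting off the pairs that contain a fixed body
  isolates the part of the potential that moves with this body.
\<close>

lemma sum_pairs_remove_index:
  fixes T :: "nat \<Rightarrow> nat \<Rightarrow> real"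
  assumes "i < N" and "\<And>j k. T j k = T k j"
  shows "(\<Sum>j<N. \<Sum>k<j. T k j)
    = (\<Sum>j\<in>{..<N} - {i}. \<Sum>k\<in>{..<j} - {i}. T k j) + (\<Sum>j\<in>{..<N} - {i}. T i j)"
  using assms(1)
proof (induction N)
  case (Suc N)
  show ?case
  proof (cases "i < N")
    case True
    have "{..<Suc N} - {i} = insert N ({..<N} - {i})" using True by auto
    moreover have "(\<Sum>k<N. T k N) = T i N + (\<Sum>k\<in>{..<N} - {i}. T k N)"
      using True by (subst sum.remove[of _ i]) auto
    ultimately show ?thesis using Suc.IH True by simp
  next
    case False
    then have i: "i = N" using Suc.prems by simp
    have "{..<Suc N} - {i} = {..<N}" using i by auto
    moreover have "(\<Sum>k\<in>{..<j} - {i}. T k j) = (\<Sum>k<j. T k j)" if "j < N" for j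
      using that i by (intro sum.cong) auto
    ultimately show ?thesis using i assms(2) by simp
  qed
qed simp

lemma GDERIV_newton_potential:
  assumes "i < N" and "\<And>j. j < N \<Longrightarrow> j \<noteq> i \<Longrightarrow> q j \<noteq> q i"
  shows "GDERIV (\<lambda>x. newton_potential N \<mu> (q(i := x))) (q i) :>
    (\<Sum>j<N. (\<mu> i * \<mu> j) *\<^sub>R attraction (q i) (q j))"
proof -
  define K where "K = (\<Sum>j\<in>{..<N} - {i}. \<Sum>k\<in>{..<j} - {i}. \<mu> k * \<mu> j / norm (q k - q j))"
  have "newton_potential N \<mu> (q(i := x)) =
    K + (\<Sum>j\<in>{..<N} - {i}. \<mu> i * \<mu> j / norm (x - q j))" for x
    unfolding newton_potential_def K_def
    by (subst sum_pairs_remove_index[OF assms(1)])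
      (auto intro!: sum.cong simp: norm_minus_commute mult.commute)
  moreover have "GDERIV (\<lambda>x. K + (\<Sum>j\<in>{..<N} - {i}. \<mu> i * \<mu> j / norm (x - q j))) (q i) :>
      0 + (\<Sum>j\<in>{..<N} - {i}. (\<mu> i * \<mu> j) *\<^sub>R attraction (q i) (q j))"
  proof (rule GDERIV_add[OF GDERIV_const])
    have "GDERIV (\<lambda>x. \<mu> i * \<mu> j / norm (x - q j)) (q i) :> (\<mu> i * \<mu> j) *\<^sub>R attraction (q i) (q j)"
      if "j \<in> {..<N} - {i}" for j
      using that assms(2) by (intro GDERIV_inverse_norm) force
    then show "GDERIV (\<lambda>x. \<Sum>j\<in>{..<N} - {i}. \<mu> i * \<mu> j / norm (x - q j)) (q i) :>
        (\<Sum>j\<in>{..<N} - {i}. (\<mu> i * \<mu> j) *\<^sub>R attraction (q i) (q j))"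
      unfolding gderiv_def inner_sum_right by (intro has_derivative_sum) auto
  qed
  moreover have "(\<Sum>j\<in>{..<N} - {i}. (\<mu> i * \<mu> j) *\<^sub>R attraction (q i) (q j))
      = (\<Sum>j<N. (\<mu> i * \<mu> j) *\<^sub>R attraction (q i) (q j))"
    by (rule sum.mono_neutral_left) (auto simp: attraction_def)
  ultimately show ?thesis by simp
qed

lemma GDERIV_unique:
  fixes f :: "'a::{real_inner} \<Rightarrow> real"
  assumes "GDERIV f x :> g" and "GDERIV f x :> g'"
  shows "g = g'"
proof -
  have "(\<lambda>h. h \<bullet> g) = (\<lambda>h. h \<bullet> g')"
    using assms has_derivative_unique unfolding gderiv_def by blast
  then have "(g - g') \<bullet> g = (g - g') \<bullet> g'" by metis
  then have "(g - g') \<bullet> (g - g') = 0" by (simp add: inner_diff_right)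
  then show ?thesis by simp
qed

lemma central_configuration_iff_balance:
  assumes "inj_on q {..<N}"
  shows "central_configuration N \<mu> q \<longleftrightarrow> (\<exists>l. \<forall>i<N.
    (\<Sum>j<N. (\<mu> i * \<mu> j) *\<^sub>R attraction (q i) (q j)) + (l * \<mu> i) *\<^sub>R q i = 0)"
proof -
  have "GDERIV (\<lambda>x. newton_potential N \<mu> (q(i := x))) (q i) :> g \<longleftrightarrow>
      g = (\<Sum>j<N. (\<mu> i * \<mu> j) *\<^sub>R attraction (q i) (q j))" if "i < N" for i g
  proof -
    have "q j \<noteq> q i" if "j < N" "j \<noteq> i" for j
      using inj_onD[OF assms, of j i] that \<open>i < N\<close> by auto
    then show ?thesis
      using GDERIV_newton_potential[OF \<open>i < N\<close>, of q \<mu>] GDERIV_unique by blast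
  qed
  then show ?thesis unfolding central_configuration_def by auto
qed

section \<open>The crown equation\<close>

lemma attraction_rotate:
  "attraction (cis \<phi> * p) (cis \<phi> * x) = cis \<phi> * attraction p x"
proof -
  have "cis \<phi> * x - cis \<phi> * p = cis \<phi> * (x - p)" by (simp add: algebra_simps)
  then show ?thesis by (simp add: attraction_def norm_mult)
qed

lemma attraction_scale:
  assumes "a > 0"
  shows "attraction (of_real a * p) (of_real a * x) = attraction p x /\<^sub>R a\<^sup>2"
proof -
  have "of_real a * x - of_real a * p = a *\<^sub>R (x - p)" by (simp add: algebra_simps scaleR_conv_of_real)
  then show ?thesis using assms
    by (simp add: attraction_def norm_mult power_mult_distrib power2_eq_square power3_eq_cube)
qed

text \<open>
  This carries the rotational symmetry of a crown: turning a regular polygon by one step only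
  renumbers its vertices.
\<close>

lemma sum_lessThan_periodic_shift:
  fixes h :: "nat \<Rightarrow> 'a::ab_group_add"
  assumes "\<And>j. h (j + n) = h j"
  shows "(\<Sum>j<n. h (j + d)) = (\<Sum>j<n. h j)"
proof (induction d)
  case (Suc d)
  have "(\<Sum>j<n. h (Suc j + d)) + h d = (\<Sum>j<n. h (j + d)) + h (n + d)"
    using sum.lessThan_Suc_shift[of "\<lambda>j. h (j + d)" n] by (simp add: add.commute)
  then show ?case using Suc assms[of d] by (simp add: add.commute)
qed simp

lemma cis_add_2pi: "cis (x + 2 * pi) = cis x"
  by (simp add: cis.ctr)

lemma norm_cis_diff_squared:
  "(norm (of_real r * cis x - of_real s))\<^sup>2 = r\<^sup>2 + s\<^sup>2 - 2 * r * s * cos x"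
proof -
  have "(r * cos x - s)\<^sup>2 + (r * sin x)\<^sup>2 = r\<^sup>2 * ((sin x)\<^sup>2 + (cos x)\<^sup>2) + s\<^sup>2 - 2 * r * s * cos x"
    by algebra
  then show ?thesis by (simp add: cmod_power2)
qed

lemma norm_cube_powr: "norm x ^ 3 = (norm x)\<^sup>2 powr (3 / 2)"
proof (cases "x = 0")
  case False
  then have "(norm x)\<^sup>2 powr (3 / 2) = norm x powr (2 * (3 / 2))"
    by (subst powr_powr[symmetric]) (simp add: powr_realpow)
  then show ?thesis using False by (simp add: powr_realpow)
qed simp

lemma attraction_cis:
  "attraction (of_real s) (of_real r * cis x) =
    Complex ((r * cos x - s) / (r\<^sup>2 + s\<^sup>2 - 2 * r * s * cos x) powr (3 / 2))
            (r * sin x / (r\<^sup>2 + s\<^sup>2 - 2 * r * s * cos x) powr (3 / 2))"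
proof -
  have "z /\<^sub>R d = Complex (Re z / d) (Im z / d)" for z d
    by (simp only: complex_eq_iff complex.sel scaleR_complex.sel divide_inverse mult.commute)
  then show ?thesis
    unfolding attraction_def norm_cube_powr norm_cis_diff_squared by simp
qed

text \<open>
  The polygon seen from a vertex of the other polygon is symmetric about the axis through that
  vertex, so the transversal components of the attractions cancel.
\<close>

lemma \<theta>_reflect:
  assumes "n > 0" and "k \<in> {1..n}"
  shows "cos (\<theta> n (n + 1 - k)) = cos (\<theta> n k)" and "sin (\<theta> n (n + 1 - k)) = - sin (\<theta> n k)"
proof -
  have "\<theta> n (n + 1 - k) = 2 * pi - \<theta> n k"
    using assms by (simp add: \<theta>_def of_nat_diff field_simps)
  then show "cos (\<theta> n (n + 1 - k)) = cos (\<theta> n k)" "sin (\<theta> n (n + 1 - k)) = - sin (\<theta> n k)"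
    by simp_all
qed

lemma sum_sin_\<theta>_eq_0:
  assumes "n > 0"
  shows "(\<Sum>k=1..n. sin (\<theta> n k) * g (cos (\<theta> n k))) = 0"
proof -
  have "(\<Sum>k=1..n. sin (\<theta> n k) * g (cos (\<theta> n k)))
      = (\<Sum>k=1..n. sin (\<theta> n (n + 1 - k)) * g (cos (\<theta> n (n + 1 - k))))"
    by (rule sum.atLeastAtMost_rev)
  also have "\<dots> = (\<Sum>k=1..n. - (sin (\<theta> n k) * g (cos (\<theta> n k))))"
    using \<theta>_reflect[OF assms] by (intro sum.cong) auto
  finally show ?thesis by (simp add: sum_negf)
qed

text \<open>
  Up to sign, the attraction of a vertex of the unit polygon by the other polygon with unit masses;
  for \<open>C21\<close> the roles of the two polygons are exchanged.
\<close>

definition C12 :: "nat \<Rightarrow> real \<Rightarrow> real" where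
  "C12 n a =
     (\<Sum>k=1..n. (1 - a * cos (\<theta> n k)) / (1 + a\<^sup>2 - 2 * a * cos (\<theta> n k)) powr (3 / 2))"

lemma sum_attraction_outer:
  assumes "n > 0"
  shows "(\<Sum>k=1..n. attraction 1 (of_real a * cis (\<theta> n k))) = - of_real (C12 n a)"
proof -
  have "attraction 1 (of_real a * cis x) = Complex
     (- ((1 - a * cos x) / (1 + a\<^sup>2 - 2 * a * cos x) powr (3 / 2)))
     (sin x * (a / (1 + a\<^sup>2 - 2 * a * cos x) powr (3 / 2)))" for x
  proof -
    have eq: "a\<^sup>2 + 1\<^sup>2 - 2 * a * 1 * cos x = 1 + a\<^sup>2 - 2 * a * cos x" by simp
    then show ?thesis
      using attraction_cis[of 1 a x, unfolded eq]
      by (simp add: minus_divide_left mult.commute[of a "sin x"])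
  qed
  then show ?thesis
    using sum_sin_\<theta>_eq_0[OF assms, of "\<lambda>c. a / (1 + a\<^sup>2 - 2 * a * c) powr (3 / 2)"]
    by (simp add: complex_eq_iff C12_def sum_negf)
qed

lemma sum_attraction_inner:
  assumes "n > 0"
  shows "(\<Sum>k=1..n. attraction (of_real a) (cis (\<theta> n k))) = - of_real (C21 n a)"
proof -
  have "attraction (of_real a) (cis x) = Complex
     (- ((a - cos x) / (1 + a\<^sup>2 - 2 * a * cos x) powr (3 / 2)))
     (sin x * (1 / (1 + a\<^sup>2 - 2 * a * cos x) powr (3 / 2)))" for x
    using attraction_cis[of a 1 x] by (simp add: minus_divide_left)
  then show ?thesis
    using sum_sin_\<theta>_eq_0[OF assms, of "\<lambda>c. 1 / (1 + a\<^sup>2 - 2 * a * c) powr (3 / 2)"]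
    by (simp add: complex_eq_iff C21_def sum_negf)
qed

lemma sin_half_turn_pos:
  assumes "k \<in> {1..n - 1}" shows "sin (real k * pi / real n) > 0"
proof -
  have "real k < real n" "k \<ge> 1" using assms by auto
  then show ?thesis by (intro sin_gt_zero) (auto simp: field_simps)
qed

lemma sum_attraction_ring:
  assumes "n > 0"
  shows "(\<Sum>j<n. attraction 1 (cis (2 * pi * real j / real n))) = - of_real (S n)"
proof -
  define x where "x k = real k * pi / real n" for k
  define P where "P k = (2 - 2 * cos (2 * x k)) powr (3 / 2)" for k
  have att: "attraction 1 (cis (2 * pi * real k / real n)) =
      Complex (- ((1 - cos (2 * x k)) / P k)) (sin (2 * x k) / P k)" for k
  proof -
    have "2 * pi * real k / real n = 2 * x k" by (simp add: x_def)
    then show ?thesis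
      using attraction_cis[of 1 1 "2 * x k"] by (simp add: P_def minus_divide_left)
  qed
  have re: "(1 - cos (2 * x k)) / P k = 1 / (4 * sin (x k))" if "k \<in> {1..n-1}" for k
  proof -
    have s: "sin (x k) > 0" using sin_half_turn_pos[OF that] by (simp add: x_def)
    have "2 - 2 * cos (2 * x k) = (2 * sin (x k))\<^sup>2"
      by (simp add: cos_double_sin power_mult_distrib)
    then have "P k = (2 * sin (x k)) ^ 3"
      using norm_cube_powr[of "complex_of_real (2 * sin (x k))"] s by (simp add: P_def)
    moreover have "1 - cos (2 * x k) = 2 * (sin (x k))\<^sup>2"
      by (simp add: cos_double_sin)
    ultimately have "(1 - cos (2 * x k)) / P k = 2 * (sin (x k))\<^sup>2 / (2 * sin (x k)) ^ 3"
      by (simp only:)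
    then show ?thesis using s by (simp add: power2_eq_square power3_eq_cube)
  qed
  have im: "(\<Sum>k=1..n-1. sin (2 * x k) / P k) = 0"
  proof -
    have refl: "sin (2 * x (n - k)) / P (n - k) = - (sin (2 * x k) / P k)" if "k \<in> {1..n-1}" for k
    proof -
      have "2 * x (n - k) = 2 * pi - 2 * x k"
        using that assms by (auto simp: x_def of_nat_diff field_simps)
      then show ?thesis by (simp add: P_def)
    qed
    have "(\<Sum>k=1..n-1. sin (2 * x k) / P k)
        = (\<Sum>k=1..n-1. sin (2 * x (n - 1 + 1 - k)) / P (n - 1 + 1 - k))"
      by (rule sum.atLeastAtMost_rev)
    also have "\<dots> = (\<Sum>k=1..n-1. - (sin (2 * x k) / P k))"
      using refl assms by (intro sum.cong) auto
    finally show ?thesis by (simp add: sum_negf)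
  qed
  have "(\<Sum>j<n. attraction 1 (cis (2 * pi * real j / real n)))
      = (\<Sum>j=1..n-1. attraction 1 (cis (2 * pi * real j / real n)))"
    by (rule sum.mono_neutral_right) (auto simp: attraction_def Suc_le_eq)
  also have "\<dots> = - of_real (\<Sum>k=1..n-1. 1 / (4 * sin (x k)))"
    using im re by (simp add: att complex_eq_iff sum_negf)
  also have "(\<Sum>k=1..n-1. 1 / (4 * sin (x k))) = S n"
    by (simp add: S_def x_def sum_distrib_left)
  finally show ?thesis .
qed


text \<open>
  Rotating by \<open>- \<beta>\<close> moves the attracted body to the positive real axis. When \<open>\<beta>\<close> exceeds the
  reference angle \<open>\<beta>'\<close> by \<open>d\<close> steps of the polygon, the renumbering by \<open>d\<close> makes the sum
  independent of \<open>d\<close>. The four mutual forces of the two polygons are instances.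
\<close>

lemma sum_attraction_polygon:
  assumes "n > 0" and "\<beta> = \<beta>' + 2 * pi * real d / real n"
  shows "(\<Sum>j<n. attraction (of_real s * cis \<beta>) (of_real r * cis (\<alpha> + 2 * pi * real j / real n)))
    = cis \<beta> * (\<Sum>j<n. attraction (of_real s) (of_real r * cis (\<alpha> - \<beta>' + 2 * pi * real j / real n)))"
proof -
  define K where
    "K j = attraction (of_real s) (of_real r * cis (\<alpha> + 2 * pi * real j / real n - \<beta>))" for j
  have "K (j + n) = K j" for j
  proof -
    have "\<alpha> + 2 * pi * real (j + n) / real n - \<beta> = (\<alpha> + 2 * pi * real j / real n - \<beta>) + 2 * pi"
      using assms(1) by (simp add: field_simps)
    then show ?thesis unfolding K_def by (simp only: cis_add_2pi)
  qed
  then have shift: "(\<Sum>j<n. K (j + d)) = (\<Sum>j<n. K j)"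
    by (rule sum_lessThan_periodic_shift)
  have "\<alpha> + 2 * pi * real (j + d) / real n - \<beta> = \<alpha> - \<beta>' + 2 * pi * real j / real n" for j
    using assms by (simp add: field_simps)
  then have "(\<Sum>j<n. K (j + d)) =
      (\<Sum>j<n. attraction (of_real s) (of_real r * cis (\<alpha> - \<beta>' + 2 * pi * real j / real n)))"
    unfolding K_def by (simp only:)
  moreover have "attraction (of_real s * cis \<beta>) (of_real r * cis (\<alpha> + 2 * pi * real j / real n))
      = cis \<beta> * K j" for j
  proof -
    have "of_real r * cis (\<alpha> + 2 * pi * real j / real n)
        = cis \<beta> * (of_real r * cis (\<alpha> + 2 * pi * real j / real n - \<beta>))"
      by (simp add: cis_mult)
    then show ?thesis
      unfolding K_def attraction_rotate[symmetric] by (simp only: mult.commute[of "cis \<beta>" "of_real s"])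
  qed
  ultimately show ?thesis using shift by (simp flip: sum_distrib_left)
qed

lemma crown_position_inner: "i < n \<Longrightarrow> crown_position n a i = cis (2 * pi * real i / real n)"
  by (simp add: crown_position_def)

lemma crown_position_outer:
  "crown_position n a (n + i) = of_real a * cis (pi / real n + 2 * pi * real i / real n)"
  by (simp add: crown_position_def)

lemma sum_lessThan_double:
  fixes h :: "nat \<Rightarrow> 'a::comm_monoid_add"
  shows "(\<Sum>j<2 * n. h j) = (\<Sum>j<n. h j) + (\<Sum>j<n. h (n + j))"
proof -
  have "(\<Sum>j<n + k. h j) = (\<Sum>j<n. h j) + (\<Sum>j<k. h (n + j))" for k
    by (induction k) (simp_all add: add.assoc)
  then show ?thesis by (simp add: mult_2)
qed

lemma sum_\<theta>_eq_sum_lessThan: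
  assumes "n > 0"
  shows "(\<Sum>k=1..n. g (\<theta> n k)) = (\<Sum>j<n. g (pi / real n + 2 * pi * real j / real n))"
proof -
  have "\<theta> n (Suc j) = pi / real n + 2 * pi * real j / real n" for j
    using assms by (simp add: \<theta>_def field_simps)
  then show ?thesis by (simp add: sum.atLeast1_atMost_eq)
qed

lemma inner_force:
  assumes "i < n"
  shows "(\<Sum>j<2 * n. (crown_mass n m i * crown_mass n m j) *\<^sub>R
      attraction (crown_position n a i) (crown_position n a j))
    = - of_real (S n + m * C12 n a) * crown_position n a i"
proof -
  let ?\<beta> = "2 * pi * real i / real n"
  have n: "n > 0" using assms by simp
  have own: "(\<Sum>j<n. attraction (cis ?\<beta>) (cis (2 * pi * real j / real n))) = - of_real (S n) * cis ?\<beta>"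
    using sum_attraction_polygon[OF n, of ?\<beta> 0 i 1 1 0] sum_attraction_ring[OF n] by simp
  have other: "(\<Sum>j<n. attraction (cis ?\<beta>) (of_real a * cis (pi / real n + 2 * pi * real j / real n)))
      = - of_real (C12 n a) * cis ?\<beta>"
    using sum_attraction_polygon[OF n, of ?\<beta> 0 i 1 a "pi / real n"] sum_attraction_outer[OF n]
      sum_\<theta>_eq_sum_lessThan[OF n, of "\<lambda>x. attraction 1 (of_real a * cis x)"] by simp
  have "(\<Sum>j<2 * n. (crown_mass n m i * crown_mass n m j) *\<^sub>R
      attraction (crown_position n a i) (crown_position n a j))
    = (\<Sum>j<n. attraction (cis ?\<beta>) (cis (2 * pi * real j / real n)))
    + m *\<^sub>R (\<Sum>j<n. attraction (cis ?\<beta>) (of_real a * cis (pi / real n + 2 * pi * real j / real n)))"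
    unfolding sum_lessThan_double scaleR_right.sum using assms
    by (intro arg_cong2[where f = "(+)"] sum.cong)
      (simp_all add: crown_mass_def crown_position_inner crown_position_outer)
  also have "\<dots> = - of_real (S n + m * C12 n a) * cis ?\<beta>"
    unfolding own other by (simp add: scaleR_conv_of_real algebra_simps)
  finally show ?thesis using assms by (simp add: crown_position_inner)
qed

lemma outer_force:
  assumes "i < n" and "a > 0"
  shows "(\<Sum>j<2 * n. (crown_mass n m (n + i) * crown_mass n m j) *\<^sub>R
      attraction (crown_position n a (n + i)) (crown_position n a j))
    = - of_real (m * (C21 n a + m * S n / a\<^sup>2) / a) * crown_position n a (n + i)"
proof -
  let ?\<beta> = "pi / real n + 2 * pi * real i / real n"
  have n: "n > 0" using assms by simp
  have "(\<Sum>j<n. attraction (of_real a) (of_real a * cis (2 * pi * real j / real n)))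
      = - of_real (S n / a\<^sup>2)"
  proof -
    have scale: "attraction (of_real a) (of_real a * x) = attraction 1 x /\<^sub>R a\<^sup>2" for x
      using attraction_scale[OF assms(2), of 1 x] by simp
    show ?thesis
      unfolding scale scaleR_right.sum[symmetric] sum_attraction_ring[OF n]
      by (simp add: scaleR_conv_of_real field_simps)
  qed
  then have own: "(\<Sum>j<n. attraction (of_real a * cis ?\<beta>)
      (of_real a * cis (pi / real n + 2 * pi * real j / real n))) = - of_real (S n / a\<^sup>2) * cis ?\<beta>"
    using sum_attraction_polygon[OF n, of ?\<beta> "pi / real n" i a a "pi / real n"] by simp
  have \<beta>: "?\<beta> = - (pi / real n) + 2 * pi * real (Suc i) / real n"
    using n by (simp add: field_simps)
  have other: "(\<Sum>j<n. attraction (of_real a * cis ?\<beta>) (cis (2 * pi * real j / real n)))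
      = - of_real (C21 n a) * cis ?\<beta>"
    using sum_attraction_polygon[OF n \<beta>, of a 1 0] sum_attraction_inner[OF n]
      sum_\<theta>_eq_sum_lessThan[OF n, of "\<lambda>x. attraction (of_real a) (cis x)"] by simp
  have "(\<Sum>j<2 * n. (crown_mass n m (n + i) * crown_mass n m j) *\<^sub>R
      attraction (crown_position n a (n + i)) (crown_position n a j))
    = m *\<^sub>R (\<Sum>j<n. attraction (of_real a * cis ?\<beta>) (cis (2 * pi * real j / real n)))
    + (m * m) *\<^sub>R (\<Sum>j<n. attraction (of_real a * cis ?\<beta>)
        (of_real a * cis (pi / real n + 2 * pi * real j / real n)))"
    unfolding sum_lessThan_double scaleR_right.sum using assms
    by (intro arg_cong2[where f = "(+)"] sum.cong)
      (simp_all add: crown_mass_def crown_position_inner crown_position_outer)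
  also have "\<dots> = - of_real (m * (C21 n a + m * S n / a\<^sup>2)) * cis ?\<beta>"
    unfolding own other by (simp add: scaleR_conv_of_real algebra_simps)
  finally show ?thesis using assms by (simp add: crown_position_outer)
qed

lemma inj_on_crown_position:
  assumes "a > 0"
  shows "inj_on (crown_position n a) {..<2 * n}"
proof (cases "n = 0")
  case False
  then have n: "n > 0" by simp
  define w where "w i = cis (2 * pi * real i / real n)" for i
  have inj: "inj_on w {..<n}"
    using bij_betw_imp_inj_on[OF Complex.bij_betw_roots_unity[OF n]] by (simp add: w_def[abs_def])
  have power: "w i ^ n = 1" for i
    using n by (simp add: w_def Complex.DeMoivre cis_multiple_2pi)
  have outer: "crown_position n a (n + i) = of_real a * (cis (pi / real n) * w i)" for i
    by (simp add: crown_position_outer w_def cis_mult)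
  have mixed: "w i \<noteq> of_real a * (cis (pi / real n) * w j)" for i j
  proof
    assume eq: "w i = of_real a * (cis (pi / real n) * w j)"
    then have "norm (w i) = norm (of_real a * (cis (pi / real n) * w j))" by simp
    then have "a = 1" using assms by (simp add: w_def norm_mult)
    then have "w i ^ n = cis (pi / real n) ^ n * w j ^ n"
      using eq by (simp add: power_mult_distrib)
    then show False using n by (simp add: power Complex.DeMoivre)
  qed
  have split: "i < n \<or> (\<exists>j<n. i = n + j)" if "i < 2 * n" for i
    using that by (cases "i < n") (auto intro!: exI[of _ "i - n"])
  show ?thesis
  proof (rule inj_onI)
    fix i j assume "i \<in> {..<2 * n}" "j \<in> {..<2 * n}"
      and eq: "crown_position n a i = crown_position n a j"
    then have "i < n \<or> (\<exists>k<n. i = n + k)" "j < n \<or> (\<exists>k<n. j = n + k)"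
      using split by auto
    then show "i = j"
      using eq assms mixed inj_onD[OF inj]
      by (elim disjE exE conjE) (auto simp: outer crown_position_inner simp flip: w_def dest: sym)
  qed
qed simp

text \<open>
  By symmetry the total force on each body is radial and has the same strength on all bodies of one
  polygon, so the \<open>2 n\<close> vector equations reduce to two real ones. The first polygon determines the
  multiplier, \<open>l = S n + m * C12 n a\<close>; inserting it for the second polygon leaves one equation.
\<close>

lemma twisted_crown_iff_balance:
  assumes "n > 0"
  shows "twisted_crown n a m \<longleftrightarrow> a > 0 \<and> m > 0 \<and>
    a * (S n + m * C12 n a) = C21 n a + m * S n / a\<^sup>2"
proof (cases "a > 0 \<and> m > 0")
  case True
  let ?force = "\<lambda>i. \<Sum>j<2 * n. (crown_mass n m i * crown_mass n m j) *\<^sub>R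
      attraction (crown_position n a i) (crown_position n a j)"
  have inner: "?force i + (l * crown_mass n m i) *\<^sub>R crown_position n a i = 0
      \<longleftrightarrow> l = S n + m * C12 n a" if "i < n" for i l
  proof -
    have "?force i + (l * crown_mass n m i) *\<^sub>R crown_position n a i
        = of_real (l - (S n + m * C12 n a)) * crown_position n a i"
      unfolding inner_force[OF that] using that
      by (simp add: crown_mass_def scaleR_conv_of_real algebra_simps)
    then show ?thesis using that by (simp add: crown_position_inner flip: of_real_diff of_real_add of_real_mult)
  qed
  have outer: "?force (n + i) + (l * crown_mass n m (n + i)) *\<^sub>R crown_position n a (n + i) = 0
      \<longleftrightarrow> a * l = C21 n a + m * S n / a\<^sup>2" if "i < n" for i l
  proof -
    have "?force (n + i) + (l * crown_mass n m (n + i)) *\<^sub>R crown_position n a (n + i)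
        = of_real (m / a * (a * l - (C21 n a + m * S n / a\<^sup>2))) * crown_position n a (n + i)"
      unfolding outer_force[OF that conjunct1[OF True]] using that True
      by (simp add: crown_mass_def scaleR_conv_of_real field_simps)
    moreover have "crown_position n a (n + i) \<noteq> 0" using True by (simp add: crown_position_outer)
    ultimately show ?thesis using True by (simp flip: of_real_diff of_real_add of_real_mult)
  qed
  have "(\<forall>i<2 * n. P i) \<longleftrightarrow> (\<forall>i<n. P i \<and> P (n + i))" for P
  proof (safe)
    fix i assume "\<forall>i<n. P i \<and> P (n + i)" "i < 2 * n"
    then show "P i" by (cases "i < n") (use le_Suc_ex[of n i] in force)+
  qed auto
  then have "central_configuration (2 * n) (crown_mass n m) (crown_position n a) \<longleftrightarrow>
      (\<exists>l. \<forall>i<n. l = S n + m * C12 n a \<and> a * l = C21 n a + m * S n / a\<^sup>2)"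
    using True inner outer
    by (simp add: central_configuration_iff_balance inj_on_crown_position)
  then show ?thesis using True assms by (auto simp: twisted_crown_def)
qed (auto simp: twisted_crown_def)

text \<open>
  Scaling by \<open>1 / a\<close> exchanges the roles of the two polygons.
\<close>

lemma C21_inverse:
  assumes "a > 0"
  shows "C21 n (1 / a) = a\<^sup>2 * C12 n a"
proof -
  have "(1 / a - c) / (1 + (1 / a)\<^sup>2 - 2 * (1 / a) * c) powr (3 / 2)
      = a\<^sup>2 * ((1 - a * c) / (1 + a\<^sup>2 - 2 * a * c) powr (3 / 2))" if "\<bar>c\<bar> \<le> 1" for c
  proof -
    have "1 + a\<^sup>2 - 2 * a * c = (1 - a)\<^sup>2 + 2 * a * (1 - c)"
      by (simp add: power2_eq_square algebra_simps)
    then have pos: "1 + a\<^sup>2 - 2 * a * c \<ge> 0" using assms that by simp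
    have "1 + (1 / a)\<^sup>2 - 2 * (1 / a) * c = (1 + a\<^sup>2 - 2 * a * c) / a\<^sup>2"
      using assms by (simp add: power2_eq_square field_simps)
    moreover have "a\<^sup>2 powr (3 / 2) = a ^ 3"
      using norm_cube_powr[of a] assms by simp
    ultimately have "(1 + (1 / a)\<^sup>2 - 2 * (1 / a) * c) powr (3 / 2)
        = (1 + a\<^sup>2 - 2 * a * c) powr (3 / 2) / a ^ 3"
      using pos by (simp add: powr_divide)
    moreover have "1 / a - c = (1 - a * c) / a" using assms by (simp add: field_simps)
    ultimately show ?thesis
      using assms by (simp add: power2_eq_square power3_eq_cube)
  qed
  then show ?thesis by (simp add: C21_def C12_def sum_distrib_left)
qed

text \<open>
  The scaling symmetry expresses the crown equation through \<open>F\<close> alone. Zeros of \<open>F\<close> and their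
  inverses therefore delimit the intervals on which crowns can exist.
\<close>

lemma twisted_crown_iff:
  assumes "n > 0"
  shows "twisted_crown n a m \<longleftrightarrow> a > 0 \<and> m > 0 \<and> m * F n (1 / a) = a * F n a"
proof (cases "a > 0")
  case True
  have "m * F n (1 / a) - a * F n a = - a * (a * (S n + m * C12 n a) - (C21 n a + m * S n / a\<^sup>2))"
    using True by (simp add: F_def C21_inverse power2_eq_square field_simps)
  then show ?thesis using True by (auto simp: twisted_crown_iff_balance[OF assms])
qed (simp add: twisted_crown_def)

section \<open>The sign of \<open>F\<close>\<close>

lemma sin_half_\<theta>_pos:
  assumes "k \<in> {1..n}"
  shows "sin (\<theta> n k / 2) > 0"
proof -
  have "0 < 2 * real k - 1" "2 * real k - 1 < 2 * real n" using assms by auto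
  then have "0 < \<theta> n k" "(2 * real k - 1) * pi < 2 * real n * pi"
    using assms by (auto simp: \<theta>_def)
  then show ?thesis
    using assms by (intro sin_gt_zero) (auto simp: \<theta>_def divide_simps algebra_simps)
qed

lemma cos_\<theta>_less_1:
  assumes "k \<in> {1..n}"
  shows "cos (\<theta> n k) < 1"
  using cos_double_sin[of "\<theta> n k / 2"] sin_half_\<theta>_pos[OF assms] by simp

text \<open>
  Radii down to \<open>-1\<close> are allowed so that \<open>F\<close> is continuous and differentiable at \<open>0\<close>, which
  is the limit of \<open>1 / a\<close> for large radii \<open>a\<close>.
\<close>

lemma squared_distance_pos:
  fixes a c :: real
  assumes "a > -1" and "\<bar>c\<bar> \<le> 1" and "c < 1"
  shows "1 + a\<^sup>2 - 2 * a * c > 0"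
proof (cases "a > 0")
  case True
  have "1 + a\<^sup>2 - 2 * a * c = (1 - a)\<^sup>2 + 2 * a * (1 - c)"
    by (simp add: power2_eq_square algebra_simps)
  then show ?thesis using True assms by (simp add: add_nonneg_pos)
next
  case False
  have "1 + a\<^sup>2 - 2 * a * c = (1 + a)\<^sup>2 + 2 * (- a) * (1 + c)"
    by (simp add: power2_eq_square algebra_simps)
  moreover have "(1 + a)\<^sup>2 > 0" "(- a) * (1 + c) \<ge> 0"
    using False assms by (simp, intro mult_nonneg_nonneg) auto
  ultimately show ?thesis by linarith
qed

lemma squared_distance_\<theta>_pos:
  assumes "a > -1" and "k \<in> {1..n}"
  shows "1 + a\<^sup>2 - 2 * a * cos (\<theta> n k) > 0"
  using assms cos_\<theta>_less_1 by (intro squared_distance_pos) auto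

lemma continuous_on_C21: "continuous_on {-1<..} (C21 n)"
  unfolding C21_def using squared_distance_\<theta>_pos
  by (intro continuous_intros) fastforce+

lemma continuous_on_C12: "continuous_on {-1<..} (C12 n)"
  unfolding C12_def using squared_distance_\<theta>_pos
  by (intro continuous_intros) fastforce+

lemma continuous_on_F: "continuous_on {-1<..} (F n)"
  unfolding F_def by (intro continuous_intros continuous_on_C21)

lemma isCont_F: "a > -1 \<Longrightarrow> isCont (F n) a"
  using continuous_on_F[of n] by (simp add: continuous_on_eq_continuous_at)

lemma sum_cis_multiple_\<theta>:
  assumes "0 < p" and "p < n"
  shows "(\<Sum>k=1..n. cis (real p * \<theta> n k)) = 0"
proof -
  define w where "w = cis (2 * (real p * pi / real n))"
  have "cos (2 * (real p * pi / real n)) < 1"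
    using sin_half_turn_pos[of p n] assms by (simp only: cos_double_sin) force
  then have "w \<noteq> 1" unfolding w_def by (metis cis.simps(1) less_irrefl one_complex.simps(1))
  moreover have "w ^ n = 1"
  proof -
    have "real n * (2 * (real p * pi / real n)) = 2 * pi * real p" using assms by simp
    then show ?thesis unfolding w_def Complex.DeMoivre by (simp only: cis_multiple_2pi Ints_of_nat)
  qed
  ultimately have "(\<Sum>k<n. w ^ k) = 0" using geometric_sum[of w n] by simp
  moreover have "cis (real p * \<theta> n (Suc k)) = cis (real p * pi / real n) * w ^ k" for k
    by (simp add: w_def Complex.DeMoivre cis_mult \<theta>_def add_divide_distrib algebra_simps)
  ultimately show ?thesis by (simp add: sum.atLeast1_atMost_eq flip: sum_distrib_left)
qed

lemma sum_cos_multiple_\<theta>: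
  assumes "0 < p" and "p < n"
  shows "(\<Sum>k=1..n. cos (real p * \<theta> n k)) = 0"
  using arg_cong[OF sum_cis_multiple_\<theta>[OF assms], of Re] by simp

lemma S_pos:
  assumes "n \<ge> 2"
  shows "S n > 0"
  unfolding S_def using assms sin_half_turn_pos
  by (auto intro!: mult_pos_pos sum_pos simp: atLeastatMost_empty_iff)

text \<open>
  Since \<open>\<Sum> cos \<theta>\<^sub>k = 0\<close> and \<open>\<Sum> cos\<^sup>2 \<theta>\<^sub>k = n / 2\<close> for \<open>n \<ge> 3\<close>, the function
  \<open>F\<close> vanishes at \<open>0\<close> with derivative \<open>S n + n / 2 > 0\<close>.
\<close>

lemma F_pos_near_0:
  assumes "n \<ge> 3" and "d > 0"
  obtains a where "0 < a" "a < d" "F n a > 0"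
proof -
  have "((\<lambda>a. (a - c) / (1 + a\<^sup>2 - 2 * a * c) powr (3 / 2)) has_real_derivative 1 - 3 * c\<^sup>2) (at 0)" for c
    by (auto intro!: derivative_eq_intros simp: power2_eq_square)
  then have "(C21 n has_real_derivative (\<Sum>k=1..n. 1 - 3 * (cos (\<theta> n k))\<^sup>2)) (at 0)"
    unfolding C21_def by (intro DERIV_sum) auto
  moreover have "(\<Sum>k=1..n. 1 - 3 * (cos (\<theta> n k))\<^sup>2) = - real n / 2"
  proof -
    have "1 - 3 * (cos x)\<^sup>2 = - 1 / 2 - 3 / 2 * cos (2 * x)" for x :: real
      using cos_double_cos[of x] by linarith
    then show ?thesis
      using sum_cos_multiple_\<theta>[of 2 n] assms by (simp add: sum_subtractf flip: sum_distrib_left sum_divide_distrib)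
  qed
  ultimately have "(F n has_real_derivative S n + real n / 2) (at 0)"
    unfolding F_def by (auto intro!: derivative_eq_intros)
  moreover have "S n + real n / 2 > 0" using S_pos[of n] assms by simp
  ultimately obtain e where e: "e > 0" "\<And>h. 0 < h \<Longrightarrow> h < e \<Longrightarrow> F n 0 < F n (0 + h)"
    using DERIV_pos_inc_right[of "F n" _ 0] by blast
  have "F n 0 = 0"
    using sum_cos_multiple_\<theta>[of 1 n] assms by (simp add: F_def C21_def sum_negf)
  then show thesis
    using e(2)[of "min e d / 2"] e(1) assms(2) that[of "min e d / 2"] by simp
qed

text \<open>
  At \<open>a = 1\<close> both terms are sums of cosecants: \<open>S n\<close> samples \<open>1 / sin\<close> at the inner points
  \<open>k \<pi> / n\<close>, and \<open>C21 n 1\<close> at the midpoints between consecutive points, the first and the last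
  midpoint lying outside all of them. By convexity of \<open>1 / sin\<close> each inner value is at most the mean
  of the two adjacent midpoint values, and the sum of these means misses half of the two extreme
  values.
\<close>

lemma F_1_neg:
  assumes "n \<ge> 2"
  shows "F n 1 < 0"
proof -
  define s where "s k = 1 / sin (\<theta> n k / 2)" for k
  note sin_pos = sin_half_\<theta>_pos
  have "C21 n 1 = 1 / 4 * (\<Sum>k=1..n. s k)"
  proof -
    have "(1 - cos (\<theta> n k)) / (1 + 1\<^sup>2 - 2 * 1 * cos (\<theta> n k)) powr (3 / 2) = 1 / 4 * s k"
      if "k \<in> {1..n}" for k
    proof -
      let ?s = "sin (\<theta> n k / 2)"
      have c: "1 - cos (\<theta> n k) = 2 * ?s\<^sup>2" using cos_double_sin[of "\<theta> n k / 2"] by simp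
      then have "1 + 1\<^sup>2 - 2 * 1 * cos (\<theta> n k) = (2 * ?s)\<^sup>2" by (simp add: power_mult_distrib)
      then have "(1 + 1\<^sup>2 - 2 * 1 * cos (\<theta> n k)) powr (3 / 2) = (2 * ?s) ^ 3"
        using norm_cube_powr[of "2 * ?s"] sin_pos[OF that] by simp
      then show ?thesis
        using sin_pos[OF that] by (simp only: c s_def) (simp add: power2_eq_square power3_eq_cube)
    qed
    then show ?thesis unfolding C21_def sum_distrib_left by (intro sum.cong) auto
  qed
  moreover have "(\<Sum>k=1..n-1. 1 / sin (real k * pi / real n)) < (\<Sum>k=1..n. s k)"
  proof -
    have mid: "1 / sin (real k * pi / real n) \<le> (s k + s (k + 1)) / 2" if "k \<in> {1..n-1}" for k
    proof -
      define x y where "x = sin (\<theta> n k / 2)" and "y = sin (\<theta> n (k + 1) / 2)"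
      have pos: "x > 0" "y > 0" "sin (real k * pi / real n) > 0"
        using that sin_pos[of k] sin_pos[of "k + 1"] sin_half_turn_pos[OF that]
        by (auto simp: x_def y_def)
      have "x + y = 2 * sin (real k * pi / real n) * cos (pi / (2 * real n))"
      proof -
        have "(\<theta> n k / 2 + \<theta> n (k + 1) / 2) / 2 = real k * pi / real n"
          "(\<theta> n k / 2 - \<theta> n (k + 1) / 2) / 2 = - (pi / (2 * real n))"
          using that by (auto simp: \<theta>_def field_simps)
        then show ?thesis unfolding x_def y_def sin_plus_sin by (simp only: cos_minus)
      qed
      also have "\<dots> \<le> 2 * sin (real k * pi / real n)" using pos by simp
      \<comment> \<open>the convexity of \<open>1 / sin\<close> follows from concavity of \<open>sin\<close> and harmonic \<open>\<le>\<close> arithmetic mean\<close>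
      finally have "1 / sin (real k * pi / real n) \<le> 2 / (x + y)"
        using pos by (simp add: divide_simps)
      also have "2 / (x + y) \<le> (1 / x + 1 / y) / 2"
      proof -
        have "4 * (x * y) \<le> (x + y) * (x + y)"
          using sum_squares_bound[of x y] by (simp add: power2_eq_square algebra_simps)
        then show ?thesis using pos by (simp add: field_simps)
      qed
      finally show ?thesis by (simp add: s_def x_def y_def)
    qed
    have "(\<Sum>k=1..n-1. 1 / sin (real k * pi / real n)) \<le> (\<Sum>k=1..n-1. (s k + s (k + 1)) / 2)"
      using mid by (rule sum_mono)
    also have "\<dots> = ((\<Sum>k=1..n-1. s k) + (\<Sum>k=1..n-1. s (k + 1))) / 2"
      by (simp add: sum.distrib flip: sum_divide_distrib)
    also have "(\<Sum>k=1..n-1. s k) = (\<Sum>k=1..n. s k) - s n"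
      using assms by (cases n) auto
    also have "(\<Sum>k=1..n-1. s (k + 1)) = (\<Sum>k=1..n. s k) - s 1"
      using assms sum.atLeast_Suc_atMost[of 1 n s] sum.shift_bounds_cl_Suc_ivl[of s 1 "n - 1"] by simp
    also have "((\<Sum>k=1..n. s k) - s n + ((\<Sum>k=1..n. s k) - s 1)) / 2 < (\<Sum>k=1..n. s k)"
    proof -
      have "s 1 > 0" "s n > 0" using assms sin_pos by (auto simp: s_def)
      then show ?thesis by simp
    qed
    finally show ?thesis .
  qed
  ultimately show ?thesis by (simp add: F_def S_def)
qed

lemma F_at_top:
  assumes "n \<ge> 2"
  shows "filterlim (F n) at_top at_top"
proof -
  have "isCont (C12 n) 0"
    using continuous_on_C12[of n] by (simp add: continuous_on_eq_continuous_at)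
  moreover have inv: "((\<lambda>a::real. 1 / a) \<longlongrightarrow> 0) at_top"
    using tendsto_inverse_0_at_top[OF filterlim_ident] by (simp add: inverse_eq_divide)
  ultimately have "((\<lambda>a. C12 n (1 / a)) \<longlongrightarrow> C12 n 0) at_top"
    using isCont_tendsto_compose by blast
  then have "((\<lambda>a. - ((1 / a)\<^sup>2 * C12 n (1 / a))) \<longlongrightarrow> - (0\<^sup>2 * C12 n 0)) at_top"
    using inv by (intro tendsto_intros)
  moreover have "filterlim (\<lambda>a. S n * a) at_top at_top"
    using S_pos[OF assms] by (intro filterlim_tendsto_pos_mult_at_top[OF tendsto_const _ filterlim_ident])
  ultimately have "filterlim (\<lambda>a. - ((1 / a)\<^sup>2 * C12 n (1 / a)) + S n * a) at_top at_top"
    by (rule filterlim_tendsto_add_at_top)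
  moreover have "eventually (\<lambda>a. - ((1 / a)\<^sup>2 * C12 n (1 / a)) + S n * a = F n a) at_top"
    using eventually_gt_at_top[of 0]
    by eventually_elim (use C21_inverse[of "1 / _" n] in \<open>simp add: F_def\<close>)
  ultimately show ?thesis by (rule filterlim_cong[OF refl refl, THEN iffD1, rotated])
qed

section \<open>Where \<open>F\<close> vanishes it is positive at the inverse\<close>

lemma powr_three_halves: "x \<ge> 0 \<Longrightarrow> x powr (3 / 2) = sqrt x ^ 3" for x :: real
  using norm_cube_powr[of "sqrt x"] by simp

text \<open>
  Up to the factor \<open>z\<^sup>2 - 1\<close> the summands are values of the Poisson kernel at the \<open>n\<close>-th roots
  \<open>\<omega>\<close> of \<open>-1\<close>, that is, real parts of \<open>2 z / (z - \<omega>) - 1\<close>. The division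
  \<open>(z\<^sup>n + 1) / (z - \<omega>)\<close> is a polynomial in \<open>\<omega>\<close> of degree below \<open>n\<close>, of which only the
  constant term survives summation over the roots.
\<close>

lemma sum_inverse_squared_distance:
  assumes "n > 0" and "z > 1"
  shows "(\<Sum>k=1..n. 1 / (1 + z\<^sup>2 - 2 * z * cos (\<theta> n k))) = real n * (z ^ n - 1) / ((z\<^sup>2 - 1) * (z ^ n + 1))"
proof -
  define \<omega> where "\<omega> k = cis (\<theta> n k)" for k
  define \<rho> where "\<rho> k = 1 + z\<^sup>2 - 2 * z * cos (\<theta> n k)" for k
  have \<rho>_pos: "\<rho> k > 0" if "k \<in> {1..n}" for k
    using squared_distance_\<theta>_pos[of z k n] assms that by (simp add: \<rho>_def)
  have zn: "z ^ n > 1" using assms by (simp add: one_less_power)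
  have z2: "z\<^sup>2 > 1" using assms by (simp add: one_less_power)
  have root: "\<omega> k ^ n = -1" for k
  proof -
    have "real n * \<theta> n k = 2 * pi * real k - pi" using assms by (simp add: \<theta>_def field_simps)
    then have "\<omega> k ^ n = cis (2 * pi * real k) / cis pi"
      by (simp only: \<omega>_def Complex.DeMoivre cis_divide)
    then show ?thesis by (simp add: cis_multiple_2pi)
  qed
  have geometric: "1 / (of_real z - \<omega> k) = (\<Sum>i<n. \<omega> k ^ (n - Suc i) * of_real z ^ i) / of_real (z ^ n + 1)" for k
  proof -
    have "norm (\<omega> k) \<noteq> norm (complex_of_real z)" using assms by (simp add: \<omega>_def)
    then have "of_real z - \<omega> k \<noteq> 0" by (metis eq_iff_diff_eq_0)
    moreover have "of_real (z ^ n + 1) = (of_real z - \<omega> k) * (\<Sum>i<n. \<omega> k ^ (n - Suc i) * of_real z ^ i)"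
      using power_diff_sumr2[of "of_real z" n "\<omega> k"] by (simp add: root)
    moreover have "of_real (z ^ n + 1) \<noteq> (0::complex)"
      using zn by (simp only: of_real_eq_0_iff)
    ultimately show ?thesis by (simp only: divide_simps) simp
  qed
  have powers: "(\<Sum>k=1..n. \<omega> k ^ (n - Suc i)) = (if i = n - 1 then of_nat n else 0)" if "i < n" for i
  proof (cases "i = n - 1")
    case False
    then show ?thesis
      using sum_cis_multiple_\<theta>[of "n - Suc i" n] that by (simp add: \<omega>_def Complex.DeMoivre)
  qed (use that in auto)
  have "(\<Sum>k=1..n. 1 / (of_real z - \<omega> k))
      = (\<Sum>i<n. (\<Sum>k=1..n. \<omega> k ^ (n - Suc i)) * of_real z ^ i) / of_real (z ^ n + 1)"
    unfolding geometric sum_divide_distrib[symmetric] by (subst sum.swap) (simp add: sum_distrib_right)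
  also have "(\<Sum>i<n. (\<Sum>k=1..n. \<omega> k ^ (n - Suc i)) * of_real z ^ i)
      = (\<Sum>i<n. if i = n - 1 then of_nat n * of_real z ^ (n - 1) else 0)"
    by (intro sum.cong refl) (simp only: powers lessThan_iff split: if_split, simp)
  also have "\<dots> = of_real (real n * z ^ (n - 1))" using assms by simp
  finally have "Re (\<Sum>k=1..n. 1 / (of_real z - \<omega> k)) = real n * z ^ (n - 1) / (z ^ n + 1)"
    by (simp flip: of_real_divide of_real_mult of_real_power of_real_add)
  moreover have "Re (1 / (of_real z - \<omega> k)) = (z - cos (\<theta> n k)) / \<rho> k" for k
  proof -
    have "(z - cos (\<theta> n k))\<^sup>2 + (sin (\<theta> n k))\<^sup>2 = \<rho> k"
      using sin_cos_squared_add[of "\<theta> n k"] unfolding \<rho>_def by algebra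
    then show ?thesis by (simp add: Re_divide \<omega>_def)
  qed
  ultimately have half: "(\<Sum>k=1..n. (z - cos (\<theta> n k)) / \<rho> k) = real n * z ^ (n - 1) / (z ^ n + 1)"
    by simp
  \<comment> \<open>the Poisson kernel as twice the real part minus one\<close>
  have "(z\<^sup>2 - 1) * (\<Sum>k=1..n. 1 / \<rho> k) = (\<Sum>k=1..n. 2 * z * ((z - cos (\<theta> n k)) / \<rho> k) - 1)"
    unfolding sum_distrib_left
  proof (rule sum.cong)
    fix k assume k: "k \<in> {1..n}"
    have "2 * z * (z - cos (\<theta> n k)) - \<rho> k = z\<^sup>2 - 1"
      by (simp add: \<rho>_def power2_eq_square algebra_simps)
    then show "(z\<^sup>2 - 1) * (1 / \<rho> k) = 2 * z * ((z - cos (\<theta> n k)) / \<rho> k) - 1"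
      using \<rho>_pos[OF k] by (simp add: field_simps)
  qed simp
  also have "\<dots> = 2 * z * (real n * z ^ (n - 1) / (z ^ n + 1)) - real n"
    unfolding sum_subtractf sum_distrib_left[symmetric] half by simp
  also have "\<dots> = 2 * real n * z ^ n / (z ^ n + 1) - real n"
    using assms by (cases n) auto
  also have "\<dots> = real n * (z ^ n - 1) / (z ^ n + 1)" using zn by (simp add: field_simps)
  finally have "(z\<^sup>2 - 1) * (\<Sum>k=1..n. 1 / \<rho> k) = real n * (z ^ n - 1) / (z ^ n + 1)" .
  moreover have "z\<^sup>2 - 1 \<noteq> 0" using z2 by simp
  ultimately have "(\<Sum>k=1..n. 1 / \<rho> k) = real n * (z ^ n - 1) / (z ^ n + 1) / (z\<^sup>2 - 1)"
    by (metis nonzero_mult_div_cancel_left)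
  then show ?thesis unfolding \<rho>_def divide_divide_eq_left by (simp only: mult.commute)
qed

text \<open>
  Chebyshev's sum inequality for the similarly ordered families \<open>x\<^sup>2\<close> and \<open>x\<close>: the double sum of
  \<open>(x\<^sub>k\<^sup>2 - x\<^sub>l\<^sup>2) (x\<^sub>k - x\<^sub>l)\<close> has only nonnegative terms, and the pair \<open>i\<close>,
  \<open>j\<close> contributes a positive one.
\<close>

lemma Chebyshev_cubes_strict:
  fixes x :: "'a \<Rightarrow> real"
  assumes "finite A" and "\<And>i. i \<in> A \<Longrightarrow> x i > 0" and "i \<in> A" "j \<in> A" "x i \<noteq> x j"
  shows "(\<Sum>k\<in>A. (x k)\<^sup>2) * (\<Sum>k\<in>A. x k) < real (card A) * (\<Sum>k\<in>A. x k ^ 3)"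
proof -
  let ?D = "\<lambda>k l. ((x k)\<^sup>2 - (x l)\<^sup>2) * (x k - x l)"
  have D: "?D k l = (x k + x l) * (x k - x l)\<^sup>2" for k l
    by (simp add: power2_eq_square algebra_simps)
  have nonneg: "?D k l \<ge> 0" if "k \<in> A" "l \<in> A" for k l
    unfolding D using that assms(2)[of k] assms(2)[of l] by simp
  have "(\<Sum>k\<in>A. \<Sum>l\<in>A. ?D k l) > 0"
  proof (rule sum_pos2[OF assms(1) \<open>i \<in> A\<close>])
    show "0 < (\<Sum>l\<in>A. ?D i l)"
    proof (rule sum_pos2[OF assms(1) \<open>j \<in> A\<close>])
      show "0 < ?D i j" unfolding D
        using assms(2)[OF assms(3)] assms(2)[OF assms(4)] assms(5) by (intro mult_pos_pos) auto
    qed (use nonneg assms in auto)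
  qed (use nonneg in \<open>auto intro!: sum_nonneg\<close>)
  moreover have "?D k l = x k ^ 3 + x l ^ 3 - (x k)\<^sup>2 * x l - (x l)\<^sup>2 * x k" for k l
    by (simp add: power2_eq_square power3_eq_cube algebra_simps)
  then have "(\<Sum>k\<in>A. \<Sum>l\<in>A. ?D k l) = real (card A) * (\<Sum>k\<in>A. x k ^ 3) + real (card A) * (\<Sum>k\<in>A. x k ^ 3)
      - (\<Sum>k\<in>A. (x k)\<^sup>2) * (\<Sum>k\<in>A. x k) - (\<Sum>k\<in>A. (x k)\<^sup>2) * (\<Sum>k\<in>A. x k)"
    by (simp add: sum.distrib sum_subtractf flip: sum_distrib_left sum_distrib_right)
  ultimately show ?thesis by (simp add: mult.commute)
qed

text \<open>
  Let \<open>\<rho>\<^sub>k\<close> be the squared distances between the polygons. Eliminating \<open>S n\<close> by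
  \<open>F n z = 0\<close> turns the claim into
  \<open>(z\<^sup>2 - 1) \<Sum> \<rho>\<^sub>k\<^bsup>-3/2\<^esup> > (z\<^sup>5 - 1) / (z\<^sup>5 + 1) \<Sum> \<rho>\<^sub>k\<^bsup>-1/2\<^esup>\<close>.
  Chebyshev's inequality separates the exponent \<open>-3/2\<close> into \<open>-1\<close> and \<open>-1/2\<close>, and the
  closed form of \<open>\<Sum> \<rho>\<^sub>k\<^sup>-\<^sup>1\<close> gives the bound with \<open>n\<close> in place of
  \<open>5\<close>; the quotient increases with the exponent.
\<close>

lemma F_inverse_pos_at_zero:
  assumes "n \<ge> 5" and "z > 1" and "F n z = 0"
  shows "F n (1 / z) > 0"
proof -
  define c where "c k = cos (\<theta> n k)" for k
  define \<rho> where "\<rho> k = 1 + z\<^sup>2 - 2 * z * c k" for k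
  define x where "x k = 1 / sqrt (\<rho> k)" for k
  have \<rho>_pos: "\<rho> k > 0" if "k \<in> {1..n}" for k
    using squared_distance_\<theta>_pos[of z k n] assms that by (simp add: \<rho>_def c_def)
  have x_pos: "x k > 0" and x_sq: "(x k)\<^sup>2 = 1 / \<rho> k" 
    if "k \<in> {1..n}" for k
    using \<rho>_pos[OF that] by (simp_all add: x_def power_divide)
  have x_cube: "y / (1 + z\<^sup>2 - 2 * z * cos (\<theta> n k)) powr (3 / 2) = y * x k ^ 3" if "k \<in> {1..n}" for k y
    using \<rho>_pos[OF that] by (simp add: x_def \<rho>_def c_def power_divide powr_three_halves)
  have zpow: "z ^ n \<ge> z ^ 5" "z ^ 5 > 1" "z\<^sup>2 > 1"
    using assms by (auto intro: power_increasing one_less_power)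
  have C21: "C21 n z = (\<Sum>k=1..n. (z - c k) * x k ^ 3)"
    unfolding C21_def by (intro sum.cong refl) (simp only: x_cube, simp add: c_def)
  have C12: "C12 n z = (\<Sum>k=1..n. (1 - z * c k) * x k ^ 3)"
    unfolding C12_def by (intro sum.cong refl) (simp only: x_cube, simp add: c_def)
  \<comment> \<open>the factor \<open>2 z\<close> makes room for \<open>2 z cos \<theta>\<^sub>k = 1 + z\<^sup>2 - \<rho>\<^sub>k\<close>\<close>
  have "2 * z * (z\<^sup>2 * F n (1 / z)) = 2 * z * (C21 n z - z ^ 4 * C12 n z)"
  proof -
    have "C21 n z = S n * z" using assms by (simp add: F_def)
    then show ?thesis using assms by (simp add: F_def C21_inverse power2_eq_square power4_eq_xxxx field_simps)
  qed
  also have "\<dots> = (\<Sum>k=1..n. (z\<^sup>2 - 1) * (z ^ 5 + 1) * x k ^ 3 - (z ^ 5 - 1) * x k)"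
    unfolding C21 C12 sum_distrib_left sum_subtractf[symmetric]
  proof (rule sum.cong)
    fix k assume k: "k \<in> {1..n}"
    have cancel: "\<rho> k * x k ^ 3 = x k"
      using \<rho>_pos[OF k] x_sq[OF k] by (simp add: power3_eq_cube power2_eq_square)
    have "2 * z * ((z - c k) * x k ^ 3 - z ^ 4 * ((1 - z * c k) * x k ^ 3))
        = 2 * z * ((z - c k) - z ^ 4 * (1 - z * c k)) * x k ^ 3"
      by (simp add: algebra_simps)
    also have "2 * z * ((z - c k) - z ^ 4 * (1 - z * c k)) = (z\<^sup>2 - 1) * (z ^ 5 + 1) - (z ^ 5 - 1) * \<rho> k"
      unfolding \<rho>_def by algebra
    finally show "2 * z * ((z - c k) * x k ^ 3 - z ^ 4 * ((1 - z * c k) * x k ^ 3)) =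
        (z\<^sup>2 - 1) * (z ^ 5 + 1) * x k ^ 3 - (z ^ 5 - 1) * x k"
      by (simp only: left_diff_distrib mult.assoc cancel)
  qed simp
  also have "\<dots> = (z ^ 5 + 1) * ((z\<^sup>2 - 1) * (\<Sum>k=1..n. x k ^ 3)) - (z ^ 5 - 1) * (\<Sum>k=1..n. x k)"
    by (simp only: sum_subtractf sum_distrib_left[symmetric] mult.assoc) (simp only: mult.left_commute)
  also have "\<dots> > 0"
  proof -
    have "x 1 \<noteq> x 2"
    proof
      assume "x 1 = x 2"
      then have "c 1 = c 2" using assms x_sq[of 1] x_sq[of 2] \<rho>_pos[of 1] \<rho>_pos[of 2] by (simp add: \<rho>_def)
      moreover have "\<theta> n 1 < \<theta> n 2" "\<theta> n 1 \<ge> 0" "\<theta> n 2 \<le> pi" using assms by (simp_all add: \<theta>_def field_simps)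
      ultimately show False using cos_monotone_0_pi[of "\<theta> n 1" "\<theta> n 2"] by (simp add: c_def)
    qed
    then have "(\<Sum>k=1..n. (x k)\<^sup>2) * (\<Sum>k=1..n. x k) < real n * (\<Sum>k=1..n. x k ^ 3)"
      using Chebyshev_cubes_strict[of "{1..n}" x 1 2] x_pos assms by simp
    moreover have "(\<Sum>k=1..n. (x k)\<^sup>2) = real n * (z ^ n - 1) / ((z\<^sup>2 - 1) * (z ^ n + 1))"
      using sum_inverse_squared_distance[of n z] assms x_sq by (simp add: \<rho>_def c_def)
    ultimately have "real n * ((z ^ n - 1) / ((z\<^sup>2 - 1) * (z ^ n + 1)) * (\<Sum>k=1..n. x k))
        < real n * (\<Sum>k=1..n. x k ^ 3)" by simp
    then have "(z ^ n - 1) / ((z\<^sup>2 - 1) * (z ^ n + 1)) * (\<Sum>k=1..n. x k) < (\<Sum>k=1..n. x k ^ 3)"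
      using assms by (subst (asm) mult_less_cancel_left_pos) auto
    then have "(z\<^sup>2 - 1) * ((z ^ n - 1) / ((z\<^sup>2 - 1) * (z ^ n + 1)) * (\<Sum>k=1..n. x k)) < (z\<^sup>2 - 1) * (\<Sum>k=1..n. x k ^ 3)"
      using zpow by (intro mult_strict_left_mono) auto
    then have "(z ^ n - 1) / (z ^ n + 1) * (\<Sum>k=1..n. x k) < (z\<^sup>2 - 1) * (\<Sum>k=1..n. x k ^ 3)"
      using zpow by simp
    moreover have "(z ^ 5 - 1) / (z ^ 5 + 1) \<le> (z ^ n - 1) / (z ^ n + 1)"
    proof -
      have "(y - 1) / (y + 1) = 1 - 2 / (y + 1)" if "y > 1" for y :: real using that by (simp add: field_simps)
      moreover have "2 / (z ^ n + 1) \<le> 2 / (z ^ 5 + 1)" using zpow by (intro divide_left_mono) auto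
      ultimately show ?thesis using zpow by simp
    qed
    then have "(z ^ 5 - 1) / (z ^ 5 + 1) * (\<Sum>k=1..n. x k) \<le> (z ^ n - 1) / (z ^ n + 1) * (\<Sum>k=1..n. x k)"
      using x_pos by (intro mult_right_mono sum_nonneg) (auto intro: less_imp_le)
    ultimately have "(z ^ 5 - 1) / (z ^ 5 + 1) * (\<Sum>k=1..n. x k) < (z\<^sup>2 - 1) * (\<Sum>k=1..n. x k ^ 3)"
      by simp
    then show ?thesis using zpow by (simp add: field_simps)
  qed
  finally show ?thesis using assms by (simp add: zero_less_mult_iff)
qed

lemma powr_three_halves_bounds:
  fixes x B :: real
  assumes "x \<ge> 0" "B \<ge> 0"
  shows "x ^ 3 \<le> B\<^sup>2 \<Longrightarrow> x powr (3 / 2) \<le> B" and "B\<^sup>2 \<le> x ^ 3 \<Longrightarrow> B \<le> x powr (3 / 2)"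
proof -
  have "x powr (3 / 2) = sqrt (x ^ 3)" using assms by (simp add: powr_three_halves real_sqrt_power)
  then show "x ^ 3 \<le> B\<^sup>2 \<Longrightarrow> x powr (3 / 2) \<le> B" "B\<^sup>2 \<le> x ^ 3 \<Longrightarrow> B \<le> x powr (3 / 2)"
    using assms by (simp_all add: real_le_lsqrt real_le_rsqrt)
qed

lemma C21_square:
  "C21 4 a = 2 * (a - sqrt 2 / 2) / (1 + a\<^sup>2 - sqrt 2 * a) powr (3 / 2)
    + 2 * (a + sqrt 2 / 2) / (1 + a\<^sup>2 + sqrt 2 * a) powr (3 / 2)"
proof -
  have "cos (pi - pi / 4) = - sqrt 2 / 2" "cos (pi + pi / 4) = - sqrt 2 / 2" "cos (2 * pi - pi / 4) = sqrt 2 / 2"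
    by (simp_all only: cos_pi_minus cos_periodic_pi2 cos_2pi_minus) (simp_all add: cos_45 cos_add)
  moreover have "\<theta> 4 1 = pi / 4" "\<theta> 4 2 = pi - pi / 4" "\<theta> 4 3 = pi + pi / 4" "\<theta> 4 4 = 2 * pi - pi / 4"
    by (simp_all add: \<theta>_def field_simps)
  ultimately have cosines: "cos (\<theta> 4 1) = sqrt 2 / 2" "cos (\<theta> 4 2) = - sqrt 2 / 2"
      "cos (\<theta> 4 3) = - sqrt 2 / 2" "cos (\<theta> 4 4) = sqrt 2 / 2"
    by (simp_all only: cos_45)
  have indices: "{1..4} = {1, 2, 3, 4::nat}" by auto
  show ?thesis
    unfolding C21_def indices by (simp add: cosines mult.commute del: One_nat_def)
qed

lemma S_square: "S 4 = (1 + 2 * sqrt 2) / 4"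
proof -
  have indices: "{1..4 - 1} = {1, 2, 3::nat}" by auto
  have sin_135: "sin (3 * pi / 4) = sqrt 2 / 2"
    using sin_pi_minus[of "pi / 4"] by (simp add: sin_45 field_simps)
  show ?thesis unfolding S_def indices by (simp add: sin_45 sin_135) (simp add: field_simps)
qed

text \<open>
  For \<open>n = 4\<close> the exponent \<open>5\<close> in the preceding bound is too large. The square is explicit, and
  these two signs separate its zeros well enough: they place one beyond \<open>3 / 2\<close> and the other
  between \<open>2 / 3\<close> and \<open>1\<close>.
\<close>

lemma F_square_signs: "F 4 (3 / 2) < 0" "F 4 (2 / 3) > 0"
proof -
  have lower: "1414 / 1000 \<le> sqrt 2" and upper: "sqrt 2 \<le> 1415 / 1000"
    by (rule real_le_rsqrt real_le_lsqrt; simp add: power2_eq_square)+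
  show "F 4 (3 / 2) < 0"
  proof -
    \<comment> \<open>rational bounds for the powers \<open>3 / 2\<close> of the two squared distances, chosen coarse enough
      to follow from the bounds for \<open>sqrt 2\<close> by cubing\<close>
    have near: "(1 + (3 / 2)\<^sup>2 - sqrt 2 * (3 / 2)) powr (3 / 2) \<le> 121 / 100"
    proof (rule powr_three_halves_bounds)
      have "0 \<le> 1 + (3 / 2)\<^sup>2 - sqrt 2 * (3 / 2)" "1 + (3 / 2)\<^sup>2 - sqrt 2 * (3 / 2) \<le> 113 / 100"
        using lower upper by (simp_all add: power2_eq_square)
      then show "0 \<le> 1 + (3 / 2)\<^sup>2 - sqrt 2 * (3 / 2)" "(1 + (3 / 2)\<^sup>2 - sqrt 2 * (3 / 2)) ^ 3 \<le> (121 / 100)\<^sup>2"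
        using power_mono[of "1 + (3 / 2)\<^sup>2 - sqrt 2 * (3 / 2)" "113 / 100" 3]
        by (simp_all add: power2_eq_square power3_eq_cube)
    qed simp
    have far: "(1 + (3 / 2)\<^sup>2 + sqrt 2 * (3 / 2)) powr (3 / 2) \<le> 125 / 10"
    proof (rule powr_three_halves_bounds)
      have "0 \<le> 1 + (3 / 2)\<^sup>2 + sqrt 2 * (3 / 2)" "1 + (3 / 2)\<^sup>2 + sqrt 2 * (3 / 2) \<le> 538 / 100"
        using lower upper by (simp_all add: power2_eq_square)
      then show "0 \<le> 1 + (3 / 2)\<^sup>2 + sqrt 2 * (3 / 2)" "(1 + (3 / 2)\<^sup>2 + sqrt 2 * (3 / 2)) ^ 3 \<le> (125 / 10)\<^sup>2"
        using power_mono[of "1 + (3 / 2)\<^sup>2 + sqrt 2 * (3 / 2)" "538 / 100" 3]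
        by (simp_all add: power2_eq_square power3_eq_cube)
    qed simp
    have pos: "0 < 1 + (3 / 2)\<^sup>2 - sqrt 2 * (3 / 2)" "0 < 1 + (3 / 2)\<^sup>2 + sqrt 2 * (3 / 2)"
      using lower upper by (simp_all add: power2_eq_square)
    have "2 * (3 / 2 - sqrt 2 / 2) / (121 / 100) + 2 * (3 / 2 + sqrt 2 / 2) / (125 / 10) \<le> C21 4 (3 / 2)"
      unfolding C21_square using near far pos lower upper
      by (intro add_mono divide_left_mono mult_pos_pos) auto
    then show ?thesis using lower upper unfolding F_def S_square by argo
  qed
  show "F 4 (2 / 3) > 0"
  proof -
    have near: "(1 + (2 / 3)\<^sup>2 - sqrt 2 * (2 / 3)) powr (3 / 2) \<le> 1 / 2"
    proof (rule powr_three_halves_bounds)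
      have "0 \<le> 1 + (2 / 3)\<^sup>2 - sqrt 2 * (2 / 3)" "1 + (2 / 3)\<^sup>2 - sqrt 2 * (2 / 3) \<le> 6 / 10"
        using lower upper by (simp_all add: power2_eq_square)
      then show "0 \<le> 1 + (2 / 3)\<^sup>2 - sqrt 2 * (2 / 3)" "(1 + (2 / 3)\<^sup>2 - sqrt 2 * (2 / 3)) ^ 3 \<le> (1 / 2)\<^sup>2"
        using power_mono[of "1 + (2 / 3)\<^sup>2 - sqrt 2 * (2 / 3)" "6 / 10" 3]
        by (simp_all add: power2_eq_square power3_eq_cube)
    qed simp
    have far: "36 / 10 \<le> (1 + (2 / 3)\<^sup>2 + sqrt 2 * (2 / 3)) powr (3 / 2)"
    proof (rule powr_three_halves_bounds)
      have lower': "238 / 100 \<le> 1 + (2 / 3)\<^sup>2 + sqrt 2 * (2 / 3)"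
        using lower by (simp add: power2_eq_square)
      have "(36 / 10)\<^sup>2 \<le> (238 / 100 :: real) ^ 3" by (simp add: power2_eq_square power3_eq_cube)
      also have "\<dots> \<le> (1 + (2 / 3)\<^sup>2 + sqrt 2 * (2 / 3)) ^ 3" by (intro power_mono lower') simp
      finally show "(36 / 10)\<^sup>2 \<le> (1 + (2 / 3)\<^sup>2 + sqrt 2 * (2 / 3)) ^ 3" .
      show "0 \<le> 1 + (2 / 3)\<^sup>2 + sqrt 2 * (2 / 3)" using lower' by linarith
    qed simp
    have pos: "0 < 1 + (2 / 3)\<^sup>2 - sqrt 2 * (2 / 3)" "0 < 1 + (2 / 3)\<^sup>2 + sqrt 2 * (2 / 3)"
      using lower upper by (simp_all add: power2_eq_square)
    have "C21 4 (2 / 3) \<le> 2 * (2 / 3 - sqrt 2 / 2) / (1 / 2) + 2 * (2 / 3 + sqrt 2 / 2) / (36 / 10)"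
      unfolding C21_square using near far pos lower upper
      by (intro add_mono divide_left_mono divide_left_mono_neg mult_pos_pos) auto
    then show ?thesis using lower upper unfolding F_def S_square by argo
  qed
qed

section \<open>The sign pattern when \<open>F\<close> has two zeros\<close>

lemma zero_of_sign_change:
  fixes g :: "real \<Rightarrow> real"
  assumes "u < v" and "continuous_on {u..v} g" and "g u * g v < 0"
  obtains x where "u < x" "x < v" "g x = 0"
proof -
  have "\<exists>x\<ge>u. x \<le> v \<and> g x = 0"
  proof (cases "g u < 0")
    case True
    then show ?thesis using assms IVT'[of g u 0 v] by (auto simp: mult_less_0_iff)
  next
    case False
    then show ?thesis using assms IVT2'[of g v 0 u] by (auto simp: mult_less_0_iff)
  qed
  then obtain x where "x \<ge> u" "x \<le> v" "g x = 0" by blast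
  moreover from this have "x \<noteq> u" "x \<noteq> v" using assms(3) by auto
  ultimately show thesis using that by force
qed

text \<open>
  The signs of \<open>F\<close> near \<open>0\<close>, at \<open>1\<close> and near infinity put one zero on each side of
  \<open>1\<close>; as there are no further zeros, \<open>F\<close> is positive outside \<open>[z1, z2]\<close> and negative
  inside.
\<close>

locale two_zeros =
  fixes n :: nat and z1 z2 :: real
  assumes n_ge_4: "n \<ge> 4" and zeros: "{a. a > 0 \<and> F n a = 0} = {z1, z2}" and z1_less_z2: "z1 < z2"
begin

lemma F_eq_0_iff: "a > 0 \<Longrightarrow> F n a = 0 \<longleftrightarrow> a = z1 \<or> a = z2"
  using zeros by auto

lemma z1_pos: "z1 > 0" and F_z1: "F n z1 = 0" and F_z2: "F n z2 = 0"
  using zeros by auto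

lemma zero_between:
  assumes "0 < u" and "u < v" and "F n u * F n v < 0"
  shows "u < z1 \<and> z1 < v \<or> u < z2 \<and> z2 < v"
proof -
  have "continuous_on {u..v} (F n)"
    by (rule continuous_on_subset[OF continuous_on_F]) (use assms in auto)
  then obtain x where "u < x" "x < v" "F n x = 0"
    using zero_of_sign_change[of u v "F n"] assms by blast
  then show ?thesis using F_eq_0_iff[of x] assms by auto
qed

lemma F_pos_beyond: "\<exists>a>b. F n a > 0"
proof -
  have "eventually (\<lambda>a. a > b \<and> F n a > 0) at_top"
    using F_at_top[of n] n_ge_4
    by (intro eventually_conj eventually_gt_at_top) (simp add: filterlim_at_top_dense)
  then show ?thesis by (auto simp: eventually_at_top_linorder)
qed

lemma z1_less_1: "z1 < 1" and z2_greater_1: "z2 > 1"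
proof -
  have neg: "F n 1 < 0" using F_1_neg n_ge_4 by simp
  obtain a where "0 < a" "a < 1" "F n a > 0" using F_pos_near_0[of n 1] n_ge_4 by auto
  then have "z1 < 1" using zero_between[of a 1] neg z1_less_z2 by (auto simp: mult_less_0_iff)
  moreover obtain b where "b > 1" "F n b > 0" using F_pos_beyond by blast
  then have "z2 > 1" using zero_between[of 1 b] neg z1_less_z2 by (auto simp: mult_less_0_iff)
  ultimately show "z1 < 1" "z2 > 1" .
qed

lemma F_pos_left:
  assumes "0 < a" and "a < z1"
  shows "F n a > 0"
proof -
  obtain b where b: "0 < b" "b < a" "F n b > 0" using F_pos_near_0[of n a] n_ge_4 assms by auto
  have "\<not> F n a < 0" using zero_between[of b a] b assms z1_less_z2 by (auto simp: mult_less_0_iff)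
  moreover have "F n a \<noteq> 0" using F_eq_0_iff[of a] assms z1_less_z2 by auto
  ultimately show ?thesis by simp
qed

lemma F_neg_between:
  assumes "z1 < a" and "a < z2"
  shows "F n a < 0"
proof -
  have neg: "F n 1 < 0" using F_1_neg n_ge_4 by simp
  have "\<not> F n a > 0"
    using zero_between[of a 1] zero_between[of 1 a] neg assms z1_pos z1_less_1 z2_greater_1
    by (cases a "1::real" rule: linorder_cases) (auto simp: mult_less_0_iff)
  moreover have "F n a \<noteq> 0" using F_eq_0_iff[of a] assms z1_pos by auto
  ultimately show ?thesis by simp
qed

lemma F_pos_right:
  assumes "a > z2"
  shows "F n a > 0"
proof -
  obtain b where b: "b > a" "F n b > 0" using F_pos_beyond by blast
  have "\<not> F n a < 0"
    using zero_between[of a b] b assms z1_less_z2 z2_greater_1 by (auto simp: mult_less_0_iff)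
  moreover have "F n a \<noteq> 0" using F_eq_0_iff[of a] assms z1_less_z2 z2_greater_1 by auto
  ultimately show ?thesis by simp
qed

text \<open>
  This makes \<open>1 / z2 < z1 < 1 < 1 / z1 < z2\<close> the order of the critical radii: with it \<open>F(a)\<close>
  and \<open>F(1 / a)\<close> are both negative on \<open>(1, 1 / z1)\<close> and both positive beyond \<open>z2\<close>.
\<close>

lemma inverse_z2_less_z1: "1 / z2 < z1"
proof (cases "n = 4")
  case True
  have z2: "z2 > 3 / 2"
    using F_square_signs(1) F_pos_right[of "3 / 2"] F_z2 True
    by (cases z2 "3 / 2 :: real" rule: linorder_cases) auto
  have z1: "z1 > 2 / 3"
  proof (rule ccontr)
    assume "\<not> z1 > 2 / 3"
    then have "F n (2 / 3) \<le> 0" using F_neg_between[of "2 / 3"] F_z1 z2_greater_1 by (cases "z1 = 2 / 3") auto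
    then show False using F_square_signs(2) True by simp
  qed
  have "2 / 3 * (3 / 2) < z1 * z2" using z1 z2 by (intro mult_strict_mono) auto
  then show ?thesis using z2 by (simp add: divide_simps)
next
  case False
  then have "F n (1 / z2) > 0"
    using F_inverse_pos_at_zero[of n z2] n_ge_4 z2_greater_1 F_z2 by simp
  moreover have "1 / z2 < z2" using z2_greater_1 by (simp add: divide_simps less_1_mult)
  ultimately show ?thesis
    using F_neg_between[of "1 / z2"] F_z1 by (cases "1 / z2" z1 rule: linorder_cases) auto
qed

end

section \<open>Crowns from sign changes\<close>

lemma crown_between:
  assumes "n > 0" and "0 < u" and "u < v" and "m > 0"
    and "(u * F n u - m * F n (1 / u)) * (v * F n v - m * F n (1 / v)) < 0"
  shows "\<exists>a. u < a \<and> a < v \<and> twisted_crown n a m"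
proof -
  have "continuous_on {u..v} (\<lambda>a. a * F n a - m * F n (1 / a))"
    using assms(2)
    by (intro continuous_intros continuous_on_compose2[OF continuous_on_F]) (auto intro: less_trans[of _ 0])
  then obtain a where "u < a" "a < v" "a * F n a - m * F n (1 / a) = 0"
    using zero_of_sign_change[of u v "\<lambda>a. a * F n a - m * F n (1 / a)"] assms by blast
  then show ?thesis using assms by (auto simp: twisted_crown_iff)
qed

text \<open>
  As \<open>a\<close> grows, \<open>a F(a)\<close> tends to infinity while \<open>F(1 / a)\<close> tends to \<open>F(0)\<close>, so the
  crown equation has a sign change beyond every point where its left-hand side is the larger one.
\<close>

lemma crown_beyond:
  assumes "n \<ge> 2" and "b > 0" and "m > 0" and "b * F n b < m * F n (1 / b)"
  shows "\<exists>a>b. twisted_crown n a m"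
proof -
  define g where "g a = a * F n a - m * F n (1 / a)" for a
  have "((\<lambda>a. - (m * F n (1 / a))) \<longlongrightarrow> - (m * F n 0)) at_top"
    using tendsto_inverse_0_at_top[OF filterlim_ident]
    by (intro tendsto_intros isCont_tendsto_compose[OF isCont_F]) (simp_all add: inverse_eq_divide)
  moreover have "filterlim (\<lambda>a. a * F n a) at_top at_top"
    using F_at_top assms(1) by (intro filterlim_at_top_mult_at_top filterlim_ident) simp
  ultimately have "filterlim (\<lambda>a. - (m * F n (1 / a)) + a * F n a) at_top at_top"
    by (rule filterlim_tendsto_add_at_top)
  then have "filterlim g at_top at_top" by (simp add: g_def[abs_def])
  then have "eventually (\<lambda>a. a > b \<and> g a > 0) at_top"
    by (intro eventually_conj eventually_gt_at_top) (simp add: filterlim_at_top_dense)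
  then obtain v where v: "v > b" "g v > 0" by (auto simp: eventually_at_top_linorder)
  moreover have "g b * g v < 0" using v(2) assms(4) by (simp add: g_def mult_less_0_iff)
  ultimately show ?thesis using crown_between[of n b v m] assms unfolding g_def by auto
qed

section \<open>Uniqueness of the equal-mass crown for even \<open>n\<close>\<close>

text \<open>
  For even \<open>n\<close> the polygon is invariant under the half turn, which is a renumbering by
  \<open>n div 2\<close>.
\<close>

lemma sum_\<theta>_cos_negate:
  fixes g :: "real \<Rightarrow> real"
  assumes "even n" and "n > 0"
  shows "(\<Sum>k=1..n. g (- cos (\<theta> n k))) = (\<Sum>k=1..n. g (cos (\<theta> n k)))"
proof -
  define h where "h j = g (cos (pi / real n + 2 * pi * real j / real n))" for j
  have "h (j + n) = h j" for j
  proof -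
    have "pi / real n + 2 * pi * real (j + n) / real n = (pi / real n + 2 * pi * real j / real n) + 2 * pi"
      using assms by (simp add: field_simps)
    then show ?thesis unfolding h_def by (simp only: cos_periodic)
  qed
  then have "(\<Sum>j<n. h (j + n div 2)) = (\<Sum>j<n. h j)"
    by (rule sum_lessThan_periodic_shift)
  moreover have "h (j + n div 2) = g (- cos (pi / real n + 2 * pi * real j / real n))" for j
  proof -
    have "real (n div 2) = real n / 2" using assms by (simp add: real_of_nat_div)
    then have "pi / real n + 2 * pi * real (j + n div 2) / real n = (pi / real n + 2 * pi * real j / real n) + pi"
      using assms by (simp add: field_simps)
    then show ?thesis unfolding h_def by (simp only: cos_periodic_pi)
  qed
  ultimately show ?thesis
    using sum_\<theta>_eq_sum_lessThan[OF assms(2), of "\<lambda>x. g (- cos x)"]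
      sum_\<theta>_eq_sum_lessThan[OF assms(2), of "\<lambda>x. g (cos x)"] by (simp add: h_def)
qed

text \<open>
  The function \<open>x \<mapsto> x\<^bsup>-3/2\<^esup>\<close> is convex, so its decrease over an interval of fixed length
  becomes smaller as the interval moves to the right.
\<close>

lemma paired_term_antimono:
  fixes c p q :: real
  assumes "0 \<le> c" and "2 * c < p" and "p \<le> q"
  shows "(q - 2 * c) powr (- 3 / 2) - (q + 2 * c) powr (- 3 / 2)
    \<le> (p - 2 * c) powr (- 3 / 2) - (p + 2 * c) powr (- 3 / 2)"
proof (rule DERIV_nonpos_imp_nonincreasing[OF assms(3)])
  fix x assume x: "p \<le> x" "x \<le> q"
  let ?D = "(- 3 / 2) * (x - 2 * c) powr (- 5 / 2) - (- 3 / 2) * (x + 2 * c) powr (- 5 / 2)"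
  have pos: "x - 2 * c > 0" "x + 2 * c > 0" using x assms by auto
  have "((\<lambda>x. (x - 2 * c) powr (- 3 / 2) - (x + 2 * c) powr (- 3 / 2)) has_real_derivative ?D) (at x)"
    using pos by (auto intro!: derivative_eq_intros DERIV_fun_powr)
  moreover have "(x + 2 * c) powr (- 5 / 2) \<le> (x - 2 * c) powr (- 5 / 2)"
    using pos assms by (intro powr_mono2') auto
  then have "?D \<le> 0" by simp
  ultimately show "\<exists>y. ((\<lambda>x. (x - 2 * c) powr (- 3 / 2) - (x + 2 * c) powr (- 3 / 2)) has_real_derivative y) (at x) \<and> y \<le> 0"
    by blast
qed

text \<open>
  The single summands need not be monotone in \<open>p\<close>: those with negative cosine increase. Averaging
  with the half turn pairs each summand with the one of opposite cosine, and the paired terms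
  decrease.
\<close>

lemma weighted_sum_antimono:
  assumes "even n" and "n > 0" and "2 < p" and "p \<le> q"
  shows "(\<Sum>k=1..n. cos (\<theta> n k) * (q - 2 * cos (\<theta> n k)) powr (- 3 / 2))
    \<le> (\<Sum>k=1..n. cos (\<theta> n k) * (p - 2 * cos (\<theta> n k)) powr (- 3 / 2))"
proof -
  define \<phi> where "\<phi> c p = c * ((p - 2 * c) powr (- 3 / 2) - (p + 2 * c) powr (- 3 / 2))" for c p :: real
  have double: "2 * (\<Sum>k=1..n. cos (\<theta> n k) * (p - 2 * cos (\<theta> n k)) powr (- 3 / 2))
      = (\<Sum>k=1..n. \<phi> (cos (\<theta> n k)) p)" for p
    using sum_\<theta>_cos_negate[OF assms(1,2), of "\<lambda>c. c * (p - 2 * c) powr (- 3 / 2)"]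
    by (simp add: \<phi>_def right_diff_distrib sum_subtractf sum_negf)
  have "\<phi> c q \<le> \<phi> c p" if "\<bar>c\<bar> \<le> 1" for c
  proof -
    have "\<phi> c x = \<bar>c\<bar> * ((x - 2 * \<bar>c\<bar>) powr (- 3 / 2) - (x + 2 * \<bar>c\<bar>) powr (- 3 / 2))" for x
      by (cases "c \<ge> 0") (simp_all add: \<phi>_def algebra_simps)
    then show ?thesis
      using paired_term_antimono[of "\<bar>c\<bar>" p q] that assms by (simp add: mult_left_mono)
  qed
  then have "(\<Sum>k=1..n. \<phi> (cos (\<theta> n k)) q) \<le> (\<Sum>k=1..n. \<phi> (cos (\<theta> n k)) p)"
    by (intro sum_mono) simp
  then show ?thesis using double[of p] double[of q] by linarith
qed

text \<open>
  With \<open>a = t\<^sup>2\<close> the crown equation for equal masses takes a form in \<open>v = t + 1 / t\<close>, which is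
  invariant under \<open>a \<mapsto> 1 / a\<close>: the trivial solution \<open>a = 1\<close> splits off as the factor
  \<open>t ^ 4 - 1\<close>, and \<open>\<rho>\<^sub>k / a = v\<^sup>2 - 2 - 2 cos \<theta>\<^sub>k\<close>.
\<close>

lemma equal_mass_equation:
  assumes "t > 1"
  shows "t\<^sup>2 * F n (t\<^sup>2) - F n (1 / t\<^sup>2) = (t ^ 4 - 1) / t *
    (S n * ((t + 1 / t) - 1 / (t + 1 / t))
      - (\<Sum>k=1..n. cos (\<theta> n k) * ((t + 1 / t)\<^sup>2 - 2 - 2 * cos (\<theta> n k)) powr (- 3 / 2)))"
proof -
  define R where
    "R = (\<Sum>k=1..n. cos (\<theta> n k) * ((t + 1 / t)\<^sup>2 - 2 - 2 * cos (\<theta> n k)) powr (- 3 / 2))"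
  have t: "t > 0" using assms by simp
  have summand: "C / (1 + (t\<^sup>2)\<^sup>2 - 2 * t\<^sup>2 * cos (\<theta> n k)) powr (3 / 2)
      = C * ((t + 1 / t)\<^sup>2 - 2 - 2 * cos (\<theta> n k)) powr (- 3 / 2) / t ^ 3" if "k \<in> {1..n}" for k C
  proof -
    let ?p = "(t + 1 / t)\<^sup>2 - 2 - 2 * cos (\<theta> n k)"
    have eq: "1 + (t\<^sup>2)\<^sup>2 - 2 * t\<^sup>2 * cos (\<theta> n k) = t\<^sup>2 * ?p"
      using t by (simp add: power2_eq_square field_simps)
    have "1 + (t\<^sup>2)\<^sup>2 - 2 * t\<^sup>2 * cos (\<theta> n k) > 0"
      using that by (intro squared_distance_\<theta>_pos) (auto intro: less_le_trans[of _ 0])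
    then have "?p > 0" unfolding eq using t by (simp add: zero_less_mult_iff)
    then have "(t\<^sup>2 * ?p) powr (3 / 2) = t ^ 3 * ?p powr (3 / 2)"
      using norm_cube_powr[of t] t by (simp add: powr_mult)
    then show ?thesis unfolding eq using powr_minus[of ?p "3 / 2"] by (simp add: field_simps)
  qed
  have "t\<^sup>2 * C21 n (t\<^sup>2) - (t\<^sup>2)\<^sup>2 * C12 n (t\<^sup>2)
      = (\<Sum>k=1..n. t\<^sup>2 * (t ^ 4 - 1) / t ^ 3 *
          (cos (\<theta> n k) * ((t + 1 / t)\<^sup>2 - 2 - 2 * cos (\<theta> n k)) powr (- 3 / 2)))"
    unfolding C21_def C12_def sum_distrib_left sum_subtractf[symmetric]
  proof (rule sum.cong)
    fix k assume k: "k \<in> {1..n}"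
    let ?c = "cos (\<theta> n k)" and ?P = "((t + 1 / t)\<^sup>2 - 2 - 2 * cos (\<theta> n k)) powr (- 3 / 2)"
    have "t\<^sup>2 * ((t\<^sup>2 - ?c) * ?P / t ^ 3) - (t\<^sup>2)\<^sup>2 * ((1 - t\<^sup>2 * ?c) * ?P / t ^ 3)
        = (t\<^sup>2 * (t\<^sup>2 - ?c) - (t\<^sup>2)\<^sup>2 * (1 - t\<^sup>2 * ?c)) / t ^ 3 * ?P"
    proof -
      have "u * (x * P / T) - w * (y * P / T) = (u * x - w * y) / T * P" for u w x y P T :: real
        by (simp add: diff_divide_distrib left_diff_distrib)
      then show ?thesis .
    qed
    also have "t\<^sup>2 * (t\<^sup>2 - ?c) - (t\<^sup>2)\<^sup>2 * (1 - t\<^sup>2 * ?c) = t\<^sup>2 * (t ^ 4 - 1) * ?c"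
      by algebra
    finally show "t\<^sup>2 * ((t\<^sup>2 - ?c) / (1 + (t\<^sup>2)\<^sup>2 - 2 * t\<^sup>2 * ?c) powr (3 / 2))
        - (t\<^sup>2)\<^sup>2 * ((1 - t\<^sup>2 * ?c) / (1 + (t\<^sup>2)\<^sup>2 - 2 * t\<^sup>2 * ?c) powr (3 / 2))
        = t\<^sup>2 * (t ^ 4 - 1) / t ^ 3 * (?c * ?P)"
      unfolding summand[OF k] by simp
  qed simp
  also have "\<dots> = t\<^sup>2 * (t ^ 4 - 1) / t ^ 3 * R" unfolding R_def sum_distrib_left ..
  also have "t\<^sup>2 * (t ^ 4 - 1) / t ^ 3 = (t ^ 4 - 1) / t"
    using t by (simp add: power2_eq_square power3_eq_cube)
  finally have C: "t\<^sup>2 * C21 n (t\<^sup>2) - (t\<^sup>2)\<^sup>2 * C12 n (t\<^sup>2) = (t ^ 4 - 1) / t * R" .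
  have "(t + 1 / t) - 1 / (t + 1 / t) = (t ^ 4 + t\<^sup>2 + 1) / (t * (t\<^sup>2 + 1))"
  proof -
    have "t + 1 / t = (t\<^sup>2 + 1) / t" using t by (simp add: field_simps power2_eq_square)
    moreover have "t\<^sup>2 + 1 > 0" by (simp add: add_nonneg_pos)
    ultimately show ?thesis using t by (simp add: field_simps)
  qed
  moreover have "(t ^ 4 - 1) / t * ((t ^ 4 + t\<^sup>2 + 1) / (t * (t\<^sup>2 + 1))) = (t\<^sup>2)\<^sup>2 - 1 / t\<^sup>2"
  proof -
    have pos: "t\<^sup>2 + 1 > 0" by (simp add: add_nonneg_pos)
    have "(t ^ 4 - 1) / t * ((t ^ 4 + t\<^sup>2 + 1) / (t * (t\<^sup>2 + 1)))
        = (t ^ 4 - 1) * (t ^ 4 + t\<^sup>2 + 1) / (t\<^sup>2 * (t\<^sup>2 + 1))"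
      by (simp only: times_divide_times_eq power2_eq_square mult.assoc)
    also have "(t ^ 4 - 1) * (t ^ 4 + t\<^sup>2 + 1) = (t ^ 6 - 1) * (t\<^sup>2 + 1)" by algebra
    also have "(t ^ 6 - 1) * (t\<^sup>2 + 1) / (t\<^sup>2 * (t\<^sup>2 + 1)) = (t ^ 6 - 1) / t\<^sup>2"
      using pos by simp
    also have "\<dots> = (t\<^sup>2)\<^sup>2 - 1 / t\<^sup>2"
      using t by (simp add: field_simps flip: power_add)
    finally show ?thesis .
  qed
  ultimately have "(t ^ 4 - 1) / t * (S n * ((t + 1 / t) - 1 / (t + 1 / t))) = S n * ((t\<^sup>2)\<^sup>2 - 1 / t\<^sup>2)"
    by (simp only: mult.left_commute[of "(t ^ 4 - 1) / t" "S n"])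
  moreover have "t\<^sup>2 * F n (t\<^sup>2) - F n (1 / t\<^sup>2)
      = S n * ((t\<^sup>2)\<^sup>2 - 1 / t\<^sup>2) - (t\<^sup>2 * C21 n (t\<^sup>2) - (t\<^sup>2)\<^sup>2 * C12 n (t\<^sup>2))"
    using t by (simp add: F_def C21_inverse algebra_simps power2_eq_square)
  ultimately show ?thesis unfolding C R_def[symmetric] by (simp add: right_diff_distrib)
qed

text \<open>
  For \<open>a > 1\<close> the equation says that \<open>S n * (v - 1 / v)\<close>, strictly increasing in \<open>a\<close>, equals
  a sum that decreases in \<open>a\<close>.
\<close>

lemma equal_mass_crown_unique:
  assumes "even n" and "n \<ge> 2" and "a > 1" and "b > 1"
    and "a * F n a = F n (1 / a)" and "b * F n b = F n (1 / b)"
  shows "a = b"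
proof -
  define v where "v t = t + 1 / t" for t :: real
  define R where
    "R p = (\<Sum>k=1..n. cos (\<theta> n k) * (p - 2 - 2 * cos (\<theta> n k)) powr (- 3 / 2))" for p
  have eq: "S n * (v t - 1 / v t) = R ((v t)\<^sup>2)" if "t > 1" "t\<^sup>2 * F n (t\<^sup>2) = F n (1 / t\<^sup>2)" for t
  proof -
    have "t ^ 4 > 1" "t > 0" using that by (simp_all add: one_less_power)
    then have "(t ^ 4 - 1) / t \<noteq> 0" by (metis diff_gt_0_iff_gt divide_pos_pos less_irrefl)
    moreover have "(t ^ 4 - 1) / t * (S n * (v t - 1 / v t) - R ((v t)\<^sup>2)) = 0"
      using equal_mass_equation[OF that(1), of n] that unfolding v_def R_def by simp
    ultimately have "S n * (v t - 1 / v t) - R ((v t)\<^sup>2) = 0" by (simp only: mult_eq_0_iff simp_thms)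
    then show ?thesis by simp
  qed
  have not_less: False
    if "1 < s" "s < t" "s\<^sup>2 * F n (s\<^sup>2) = F n (1 / s\<^sup>2)" "t\<^sup>2 * F n (t\<^sup>2) = F n (1 / t\<^sup>2)" for s t
  proof -
    have "s * t > 1" using that by (simp add: less_1_mult)
    then have "(t - s) * (1 - 1 / (s * t)) > 0" using that by (intro mult_pos_pos) (auto simp: divide_simps)
    also have "(t - s) * (1 - 1 / (s * t)) = v t - v s"
      using that by (simp add: v_def field_simps)
    finally have less: "v s < v t" by simp
    have "(s - 1)\<^sup>2 / s > 0" using that by simp
    also have "(s - 1)\<^sup>2 / s = v s - 2" using that by (simp add: v_def field_simps power2_eq_square)
    finally have gt2: "v s > 2" by simp
    then have sq: "(v s)\<^sup>2 > 4" "(v s)\<^sup>2 \<le> (v t)\<^sup>2"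
      using less power_strict_mono[of 2 "v s" 2] power_mono[of "v s" "v t" 2] by auto
    have "1 / v t < 1 / v s" using less gt2 by (intro divide_strict_left_mono) auto
    then have "S n * (v s - 1 / v s) < S n * (v t - 1 / v t)"
      using less S_pos[OF assms(2)] by simp
    also have "\<dots> = R ((v t)\<^sup>2)" using eq[of t] that by simp
    also have "\<dots> \<le> R ((v s)\<^sup>2)"
      unfolding R_def using assms sq by (intro weighted_sum_antimono) auto
    also have "\<dots> = S n * (v s - 1 / v s)" using eq[of s] that by simp
    finally show False by simp
  qed
  have gt_1: "sqrt a > 1" "sqrt b > 1" and sq: "(sqrt a)\<^sup>2 = a" "(sqrt b)\<^sup>2 = b" using assms by auto
  have "\<not> sqrt a < sqrt b" "\<not> sqrt b < sqrt a"
    using not_less[of "sqrt a" "sqrt b", unfolded sq] not_less[of "sqrt b" "sqrt a", unfolded sq]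
      gt_1 assms(5,6) by blast+
  then have "sqrt a = sqrt b" by linarith
  then show ?thesis by simp
qed

section \<open>Existence of the crowns\<close>

theorem theorem4:
  fixes n :: nat and z1 z2 :: real
  assumes "n \<ge> 4"
    and "{a. a > 0 \<and> F n a = 0} = {z1, z2}" and "z1 < z2"
  shows "\<exists>a1 > 1. admissible n a1 \<and>
    (\<forall>m > 1. \<exists>x \<in> {1 / a1 <..< 1 / z2}. \<exists>y \<in> {1 <..< 1 / z1}. \<exists>z \<in> {a1 <..}.
        twisted_crown n x m \<and> twisted_crown n y m \<and> twisted_crown n z m \<and>
        different_crowns (x, m) (y, m) \<and> different_crowns (x, m) (z, m) \<and>
        different_crowns (y, m) (z, m)) \<and>
    (\<exists>a a'. twisted_crown n a 1 \<and> twisted_crown n a' 1 \<and> different_crowns (a, 1) (a', 1)) \<and>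
    (even n \<longrightarrow>
        twisted_crown n 1 1 \<and> twisted_crown n a1 1 \<and> different_crowns (1, 1) (a1, 1) \<and>
        (\<forall>a. twisted_crown n a 1 \<longrightarrow>
             \<not> different_crowns (1, 1) (a, 1) \<or> \<not> different_crowns (a1, 1) (a, 1)))"
proof -
  interpret two_zeros n z1 z2 by unfold_locales (use assms in auto)
  have n: "n > 0" using assms by simp
  note order = z1_pos z1_less_1 z2_greater_1 inverse_z2_less_z1
  have F_inv_z2: "F n (1 / z2) > 0" using F_pos_left[of "1 / z2"] order by simp
  \<comment> \<open>any equal-mass crown beyond \<open>z2\<close> serves as \<open>a1\<close>\<close>
  obtain a1 where a1: "a1 > z2" "twisted_crown n a1 1"
    using crown_beyond[of n z2 1] F_z2 F_inv_z2 order assms by auto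
  have H_a1: "a1 * F n a1 = F n (1 / a1)" using a1 n by (simp add: twisted_crown_iff)
  have F_a1: "F n a1 > 0" using F_pos_right a1 by simp
  have F_inv_a1: "F n (1 / a1) > 0" using H_a1 F_a1 a1 order by (metis less_trans mult_pos_pos zero_less_one)
  have a1_gt_1: "a1 > 1" using a1 order by simp
  have crown_1: "twisted_crown n 1 1" using n by (simp add: twisted_crown_iff)
  have diff: "different_crowns (1, 1) (a1, 1)" using a1_gt_1 by (simp add: different_crowns_def)
  have three: "\<exists>x \<in> {1 / a1 <..< 1 / z2}. \<exists>y \<in> {1 <..< 1 / z1}. \<exists>z \<in> {a1 <..}.
        twisted_crown n x m \<and> twisted_crown n y m \<and> twisted_crown n z m \<and>
        different_crowns (x, m) (y, m) \<and> different_crowns (x, m) (z, m) \<and>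
        different_crowns (y, m) (z, m)" if m: "m > 1" for m
  proof -
    \<comment> \<open>at \<open>1 / a1\<close> the side \<open>m F(1 / a)\<close> is the larger one because \<open>m > 1\<close> and the equation
      holds there for \<open>m = 1\<close>; at \<open>1 / z2\<close> that side vanishes while \<open>a F(a)\<close> is positive\<close>
    have "\<exists>x. 1 / a1 < x \<and> x < 1 / z2 \<and> twisted_crown n x m"
    proof (rule crown_between)
      show "1 / a1 < 1 / z2" using a1 order by (simp add: divide_strict_left_mono)
      have "1 / a1 * F n (1 / a1) = F n a1" using H_a1 a1_gt_1 by (simp add: field_simps)
      then have "1 / a1 * F n (1 / a1) - m * F n (1 / (1 / a1)) < 0" using F_a1 m by simp
      moreover have "1 / z2 * F n (1 / z2) - m * F n (1 / (1 / z2)) > 0"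
        using F_z2 F_inv_z2 order by simp
      ultimately show "(1 / a1 * F n (1 / a1) - m * F n (1 / (1 / a1))) *
          (1 / z2 * F n (1 / z2) - m * F n (1 / (1 / z2))) < 0" by (rule mult_neg_pos)
    qed (use n a1_gt_1 m in auto)
    then obtain x where x: "1 / a1 < x" "x < 1 / z2" "twisted_crown n x m" by blast
    have z1_inv: "1 < 1 / z1" "1 / z1 < z2" using order by (simp_all add: divide_simps mult.commute)
    \<comment> \<open>at \<open>1\<close> the side \<open>m F(1 / a)\<close> is the smaller one because \<open>F(1) < 0\<close>; at \<open>1 / z1\<close> it is \<open>0\<close> and \<open>a F(a) < 0\<close>\<close>
    have "\<exists>y. 1 < y \<and> y < 1 / z1 \<and> twisted_crown n y m"
    proof (rule crown_between)
      have "F n 1 < 0" using F_1_neg assms by simp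
      then have "1 * F n 1 - m * F n (1 / 1) > 0" using m by simp
      moreover have "1 / z1 * F n (1 / z1) - m * F n (1 / (1 / z1)) < 0"
        using F_neg_between[of "1 / z1"] z1_inv order F_z1 by (simp add: divide_less_0_iff)
      ultimately show "(1 * F n 1 - m * F n (1 / 1)) *
          (1 / z1 * F n (1 / z1) - m * F n (1 / (1 / z1))) < 0" by (rule mult_pos_neg)
    qed (use n z1_inv m in auto)
    then obtain y where y: "1 < y" "y < 1 / z1" "twisted_crown n y m" by blast
    have "F n (1 / a1) < m * F n (1 / a1)" using F_inv_a1 m by simp
    then obtain z where z: "a1 < z" "twisted_crown n z m"
      using crown_beyond[of n a1 m] H_a1 a1_gt_1 m assms by auto
    have "1 / z2 < 1" using order by simp
    then have "x < y" "y < z" using x y z z1_inv a1 by linarith+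
    moreover have "1 / m \<noteq> m" using m less_1_mult[of m m] by (auto simp: divide_simps)
    ultimately show ?thesis using x y z by (intro bexI[of _ x] bexI[of _ y] bexI[of _ z]) (auto simp: different_crowns_def)
  qed
  have unique: "\<not> different_crowns (1, 1) (a, 1) \<or> \<not> different_crowns (a1, 1) (a, 1)"
    if "even n" "twisted_crown n a 1" for a
  proof -
    have a: "a > 0" "a * F n a = F n (1 / a)" using that n by (simp_all add: twisted_crown_iff)
    consider "a = 1" | "a > 1" | "1 / a > 1" using a by (cases a "1::real" rule: linorder_cases) auto
    then have "a = 1 \<or> a = a1 \<or> a = 1 / a1"
    proof cases
      case 2
      then show ?thesis using equal_mass_crown_unique[of n a a1] that a a1_gt_1 H_a1 assms by simp
    next
      case 3
      have "1 / a * F n (1 / a) = F n (1 / (1 / a))" using a by (simp add: field_simps)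
      then have "1 / a = a1" using equal_mass_crown_unique[of n "1 / a" a1] 3 that a1_gt_1 H_a1 assms by simp
      then show ?thesis by auto
    qed simp
    then show ?thesis by (auto simp: different_crowns_def)
  qed
  have "admissible n a1" using a1 by (auto simp: admissible_def intro: exI[of _ 1])
  then show ?thesis
    using a1_gt_1 three crown_1 a1 diff unique by (intro exI[of _ a1]) blast
qed

end
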